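(* Let $\varepsilon\in(0,1)$ be fixed and let $p=p(n)$ satisfy $(\log n)^{2+\varepsilon}n^{-1}\le p<n^{-\varepsilon}$. Then there is a constant $C_\varepsilon>0$ (depending only on $\varepsilon$) such that, with probability tending to $1$ as $n\to\infty$, \[ \mathrm{pdim}(G_{n,p})\le C_\varepsilon\,\frac{pn\log n}{\log pn}. \]
   Context: $G_{n,p}$ denotes the binomial random graph on $n$ vertices in which each pair of vertices is an edge independently with probability $p$. The Prague dimension $\mathrm{pdim}(G)$ of a graph $G$ is the minimum number of complete graphs whose direct (categorical/tensor) product contains $G$ as an induced subgraph. All logarithms are natural. *)

theory Defs
  imports "HOL-Probability.Probability"
begin

text \<open>
  Graphs are undirected, with edges given as sets of endpoints. A singleton \<open>{v}\<close> would be a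
  loop; loops are excluded by \<open>simple_graph\<close>.
\<close>

record 'a ugraph =
  verts :: "'a set"
  edges :: "'a set set"

definition simple_graph :: "'a ugraph \<Rightarrow> bool" where
  "simple_graph G \<longleftrightarrow> (\<forall>e\<in>edges G. e \<subseteq> verts G \<and> card e = 2)"

definition adj :: "'a ugraph \<Rightarrow> 'a \<Rightarrow> 'a \<Rightarrow> bool" where
  "adj G u v \<longleftrightarrow> {u, v} \<in> edges G"

definition all_pairs :: "'a set \<Rightarrow> 'a set set" where
  "all_pairs V = {e. e \<subseteq> V \<and> card e = 2}"

definition complete_graph :: "nat \<Rightarrow> nat ugraph" where
  "complete_graph m = \<lparr>verts = {..<m}, edges = all_pairs {..<m}\<rparr>"

text \<open>
  The empty product (\<open>d = 0\<close>) is a single vertex with a loop, the terminal object for the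
  categorical product; no simple graph with at least one vertex is an induced subgraph of it.
\<close>

definition direct_product :: "nat \<Rightarrow> (nat \<Rightarrow> 'a ugraph) \<Rightarrow> (nat \<Rightarrow> 'a) ugraph" where
  "direct_product d H =
     \<lparr>verts = (\<Pi>\<^sub>E i\<in>{..<d}. verts (H i)),
      edges = {{u, v} |u v. u \<in> (\<Pi>\<^sub>E i\<in>{..<d}. verts (H i)) \<and> v \<in> (\<Pi>\<^sub>E i\<in>{..<d}. verts (H i)) \<and>
                            (\<forall>i<d. adj (H i) (u i) (v i))}\<rparr>"

definition induced_subgraph :: "'a ugraph \<Rightarrow> 'a ugraph \<Rightarrow> bool" where
  "induced_subgraph H G \<longleftrightarrow> verts H \<subseteq> verts G \<and> edges H = {e \<in> edges G. e \<subseteq> verts H}"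

definition graph_iso :: "'a ugraph \<Rightarrow> 'b ugraph \<Rightarrow> bool" where
  "graph_iso G H \<longleftrightarrow>
     (\<exists>f. bij_betw f (verts G) (verts H) \<and>
          (\<forall>u\<in>verts G. \<forall>v\<in>verts G. adj G u v \<longleftrightarrow> adj H (f u) (f v)))"

definition contains_induced :: "'b ugraph \<Rightarrow> 'a ugraph \<Rightarrow> bool" where
  "contains_induced P G \<longleftrightarrow> (\<exists>H. induced_subgraph H P \<and> graph_iso G H)"

text \<open>The minimum is attained for every finite simple graph, see \<open>pdim_exists\<close>.\<close>

definition pdim :: "'a ugraph \<Rightarrow> nat" where
  "pdim G = (LEAST d. \<exists>m. contains_induced (direct_product d (\<lambda>i. complete_graph (m i))) G)"

definition Gnp :: "nat \<Rightarrow> real \<Rightarrow> nat ugraph pmf" where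
  "Gnp n p =
     map_pmf (\<lambda>X. \<lparr>verts = {..<n}, edges = {e \<in> all_pairs {..<n}. X e}\<rparr>)
       (Pi_pmf (all_pairs {..<n}) False (\<lambda>_. bernoulli_pmf p))"

lemma adj_complete_graph: "adj (complete_graph m) a b \<longleftrightarrow> a < m \<and> b < m \<and> a \<noteq> b"
  by (auto simp: adj_def complete_graph_def all_pairs_def card_2_iff doubleton_eq_iff)

lemma adj_direct_product:
  "adj (direct_product d H) u v \<longleftrightarrow>
     u \<in> verts (direct_product d H) \<and> v \<in> verts (direct_product d H) \<and>
     (\<forall>i<d. adj (H i) (u i) (v i))"
proof -
  have sym: "adj (H i) a b = adj (H i) b a" for i a b
    by (simp add: adj_def insert_commute)
  have "adj (direct_product d H) u v \<longleftrightarrow> {u, v} \<in> edges (direct_product d H)"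
    by (simp only: adj_def)
  also have "\<dots> \<longleftrightarrow> (\<exists>u' v'. {u, v} = {u', v'} \<and>
      u' \<in> verts (direct_product d H) \<and> v' \<in> verts (direct_product d H) \<and>
      (\<forall>i<d. adj (H i) (u' i) (v' i)))"
    by (simp add: direct_product_def)
  also have "\<dots> \<longleftrightarrow> u \<in> verts (direct_product d H) \<and> v \<in> verts (direct_product d H) \<and>
      (\<forall>i<d. adj (H i) (u i) (v i))"
    unfolding doubleton_eq_iff using sym by blast
  finally show ?thesis .
qed

lemma pdim_exists:
  assumes "finite (verts G)" "simple_graph G"
  shows "\<exists>d m. contains_induced (direct_product d (\<lambda>i. complete_graph (m i))) G"
proof -
  let ?V = "verts G"
  define m where "m = card ?V"
  obtain c where c: "bij_betw c ?V {..<m}"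
    using ex_bij_betw_finite_nat[OF assms(1)] unfolding m_def atLeast0LessThan by blast
  have c_lt: "c v < m" if "v \<in> ?V" for v
    using c that by (auto simp: bij_betw_def)
  have c_inj: "c u = c v \<longleftrightarrow> u = v" if "u \<in> ?V" "v \<in> ?V" for u v
    using c that by (auto simp: bij_betw_def inj_on_def)
  define N where "N = {(u, v). u \<in> ?V \<and> v \<in> ?V \<and> u \<noteq> v \<and> \<not> adj G u v}"
  have "finite N"
    by (rule finite_subset[of _ "?V \<times> ?V"]) (auto simp: N_def assms(1))
  then obtain xs where xs: "set xs = N"
    using finite_list by blast
  define d where "d = Suc (length xs)"
  define col where "col i w =
    (if i < length xs \<and> w = snd (xs ! i) then c (fst (xs ! i)) else c w)" for i w
  define f where "f w = restrict (\<lambda>i. col i w) {..<d}" for w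
  define P where "P = direct_product d (\<lambda>i. complete_graph m)"
  have N: "fst (xs ! i) \<in> ?V" "snd (xs ! i) \<in> ?V" "fst (xs ! i) \<noteq> snd (xs ! i)"
    "\<not> adj G (fst (xs ! i)) (snd (xs ! i))" if "i < length xs" for i
    using nth_mem[OF that] unfolding xs N_def by auto
  have adj_sym: "adj G u v = adj G v u" for u v
    by (simp add: adj_def insert_commute)
  have irrefl: "\<not> adj G u u" for u
    using assms(2) by (auto simp: adj_def simple_graph_def)
  have col_lt: "col i w < m" if "w \<in> ?V" for i w
    using that N c_lt by (auto simp: col_def)
  have fP: "f w \<in> verts P" if "w \<in> ?V" for w
    using that col_lt by (auto simp: f_def P_def direct_product_def complete_graph_def)
  have inj: "inj_on f ?V"
  proof (rule inj_onI)
    fix u v assume uv: "u \<in> ?V" "v \<in> ?V" "f u = f v"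
    from uv(3) have "f u (length xs) = f v (length xs)" by simp
    then show "u = v" using c_inj uv by (simp add: f_def d_def col_def)
  qed
  have adjP: "adj P (f u) (f v) \<longleftrightarrow> adj G u v" if uv: "u \<in> ?V" "v \<in> ?V" for u v
  proof -
    have "adj P (f u) (f v) \<longleftrightarrow> (\<forall>i<d. col i u \<noteq> col i v)"
      using fP[OF uv(1)] fP[OF uv(2)] col_lt[OF uv(1)] col_lt[OF uv(2)]
      unfolding P_def adj_direct_product adj_complete_graph by (auto simp: f_def)
    also have "\<dots> \<longleftrightarrow> adj G u v"
    proof
      assume h: "\<forall>i<d. col i u \<noteq> col i v"
      show "adj G u v"
      proof (rule ccontr)
        assume n: "\<not> adj G u v"
        have "u \<noteq> v" using h by (auto simp: d_def)
        then have "(u, v) \<in> set xs" using n uv by (simp add: xs N_def)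
        then obtain i where "i < length xs" "xs ! i = (u, v)" by (auto simp: in_set_conv_nth)
        then have "i < d" "col i u = col i v" by (auto simp: d_def col_def)
        then show False using h by blast
      qed
    next
      assume a: "adj G u v"
      then have ne: "u \<noteq> v" using irrefl by auto
      show "\<forall>i<d. col i u \<noteq> col i v"
      proof (intro allI impI notI)
        fix i assume eq: "col i u = col i v"
        show False
        proof (cases "i < length xs")
          case True
          then show False
            using eq a ne N[OF True] uv adj_sym[of u v]
            by (auto simp: col_def c_inj split: if_splits)
        next
          case False
          then show False using eq ne uv by (simp add: col_def c_inj)
        qed
      qed
    qed
    finally show ?thesis .
  qed
  define H where "H = \<lparr>verts = f ` ?V, edges = {e \<in> edges P. e \<subseteq> f ` ?V}\<rparr>"
  have "induced_subgraph H P"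
    using fP by (auto simp: induced_subgraph_def H_def)
  moreover have "graph_iso G H"
    unfolding graph_iso_def
  proof (intro exI conjI ballI)
    show "bij_betw f (verts G) (verts H)"
      using inj by (simp add: bij_betw_def H_def)
    show "adj G u v \<longleftrightarrow> adj H (f u) (f v)" if "u \<in> ?V" "v \<in> ?V" for u v
      using adjP[OF that] that by (simp add: adj_def H_def)
  qed
  ultimately show ?thesis
    unfolding contains_induced_def P_def by (intro exI[of _ d] exI[of _ "\<lambda>_. m"]) blast
qed

end

theory Submission imports Defs begin

text \<open>
  A family of proper vertex colourings of \<open>G\<close> in which every nonadjacent pair of distinct vertices
  gets the same colour at least once, together with one injective colouring, is an embedding of \<open>G\<close>
  as an induced subgraph of a product of complete graphs. The number of colours is irrelevant.

  With \<open>s\<close> of order \<open>log (pn) / p\<close>, \<open>k\<close> of order \<open>n / s\<close> and \<open>T\<close> of order \<open>k log n\<close>, all \<open>T\<close>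
  colourings are extended simultaneously, one vertex \<open>v\<close> at a time in a fixed order. In each
  colouring, independently, \<open>v\<close> joins one of \<open>k\<close> classes (of size at most \<open>s\<close>): a class \<open>c\<close> without
  neighbours of \<open>v\<close> is chosen with probability \<open>(1 - p) ^ - card c / (2 * k)\<close>. The edges from \<open>v\<close>
  to its predecessors are independent of the past, so the sums of these weights, both over the classes
  of one colouring and over the classes of a fixed vertex \<open>u\<close> in all colourings, are concentrated.
  The latter needs that no vertex shares its class with \<open>u\<close> too often, which is maintained as an
  invariant. Hence a nonneighbour \<open>u\<close> of \<open>v\<close> shares no class with \<open>v\<close> with probability at most
  \<open>exp (- T / (80 * k))\<close>, and choices that work for all \<open>u\<close> exist. These choices are needed only for
  existence: the only randomness that matters is the one of the graph.
\<close>

section \<open>Weights of avoided sets\<close>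

text \<open>Inverse probability weight: if the coordinates in a finite \<open>B\<close> are
  independent Bernoulli variables with parameter \<open>p < 1\<close>, its expectation is 1.\<close>

definition avoid_weight :: "real \<Rightarrow> 'a set \<Rightarrow> ('a \<Rightarrow> bool) \<Rightarrow> real" where
  "avoid_weight p B Y = (if \<forall>i\<in>B. \<not> Y i then 1 / (1 - p) ^ card B else 0)"

lemma avoid_weight_nonneg: "p < 1 \<Longrightarrow> 0 \<le> avoid_weight p B Y"
  by (simp add: avoid_weight_def)

lemma finite_set_Pi_pmf_bool:
  fixes q :: "'a \<Rightarrow> bool pmf"
  assumes "finite U"
  shows "finite (set_pmf (Pi_pmf U False q))"
  using assms by (intro finite_subset[OF set_Pi_pmf_subset'] finite_PiE_dflt) auto

lemma expectation_Pi_bernoulli_insert: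
  fixes h :: "('a \<Rightarrow> bool) \<Rightarrow> real"
  assumes "finite U" "x \<notin> U" "0 \<le> p" "p \<le> 1"
  shows "measure_pmf.expectation (Pi_pmf (insert x U) False (\<lambda>_. bernoulli_pmf p)) h =
    p * measure_pmf.expectation (Pi_pmf U False (\<lambda>_. bernoulli_pmf p)) (\<lambda>f. h (f(x := True))) +
    (1 - p) * measure_pmf.expectation (Pi_pmf U False (\<lambda>_. bernoulli_pmf p)) (\<lambda>f. h (f(x := False)))"
proof -
  have fin: "finite (set_pmf (Pi_pmf U False (\<lambda>_. bernoulli_pmf p)))"
    by (rule finite_set_Pi_pmf_bool[OF assms(1)])
  have "Pi_pmf (insert x U) False (\<lambda>_. bernoulli_pmf p) =
    bernoulli_pmf p \<bind> (\<lambda>y. map_pmf (\<lambda>f. f(x := y)) (Pi_pmf U False (\<lambda>_. bernoulli_pmf p)))"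
    using assms by (simp add: Pi_pmf_insert' map_pmf_def)
  then show ?thesis
    using fin assms(3,4)
    by (simp only:) (subst pmf_expectation_bind[where A = UNIV], auto simp: UNIV_bool)
qed

section \<open>Exponential moments and concentration of sums of weights\<close>

lemma exp_le_quadratic:
  fixes x :: real
  assumes "\<bar>x\<bar> \<le> 1"
  shows "exp x \<le> 1 + x + x\<^sup>2"
proof (cases "x \<ge> 0")
  case True then show ?thesis using exp_bound assms by simp
next
  case False
  define y where "y = - x"
  have y: "0 \<le> y" "y \<le> 1" using False assms by (auto simp: y_def)
  \<comment> \<open>The product on the right is \<open>1 + y ^ 3\<close>.\<close>
  have "1 \<le> (1 + y) * (1 - y + y\<^sup>2)"
    using y by (simp add: algebra_simps power2_eq_square)
  also have "\<dots> \<le> exp y * (1 - y + y\<^sup>2)"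
    using y exp_ge_add_one_self[of y] by (intro mult_right_mono) auto
  finally have "exp (-y) \<le> 1 - y + y\<^sup>2"
    by (simp add: exp_minus field_simps)
  then show ?thesis by (simp add: y_def)
qed

text \<open>The variable that is \<open>- x\<close> with probability \<open>p\<close> and
  \<open>x * p / (1 - p)\<close> otherwise has mean zero, so the linear terms of
  \<open>exp_le_quadratic\<close> cancel. What remains is its variance, at most
  \<open>2 * p * x\<^sup>2\<close> since \<open>p / (1 - p) \<le> 1\<close>.\<close>

lemma bernoulli_factor_mgf:
  fixes p x :: real
  assumes p: "0 \<le> p" "p \<le> 1/2" and x: "\<bar>x\<bar> \<le> 1"
  shows "p * exp (- x) + (1 - p) * exp (x * p / (1 - p)) \<le> exp (2 * p * x\<^sup>2)"
proof -
  have "\<bar>x * p / (1 - p)\<bar> = \<bar>x\<bar> * (p / (1 - p))" using p by (simp add: abs_mult)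
  also have "\<dots> \<le> 1 * 1" using p x by (intro mult_mono) (auto simp: field_simps)
  finally have x': "\<bar>x * p / (1 - p)\<bar> \<le> 1" by simp
  have "p * exp (- x) + (1 - p) * exp (x * p / (1 - p))
     \<le> p * (1 + (- x) + (- x)\<^sup>2) + (1 - p) * (1 + x * p / (1 - p) + (x * p / (1 - p))\<^sup>2)"
    using p x x' by (intro add_mono mult_left_mono exp_le_quadratic) auto
  also have "\<dots> = 1 + p * x\<^sup>2 + (1 - p) * (x * p / (1 - p))\<^sup>2"
  proof -
    have "(1 - p) * (x * p / (1 - p)) = x * p" using p by simp
    then show ?thesis by (simp only: distrib_left) (simp add: algebra_simps)
  qed
  also have "(1 - p) * (x * p / (1 - p))\<^sup>2 = p * x\<^sup>2 * (p / (1 - p))"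
    using p by (simp add: power2_eq_square)
  also have "\<dots> \<le> p * x\<^sup>2 * 1"
    using p by (intro mult_left_mono) auto
  finally have "p * exp (- x) + (1 - p) * exp (x * p / (1 - p)) \<le> 1 + 2 * p * x\<^sup>2" by simp
  also have "\<dots> \<le> exp (2 * p * x\<^sup>2)" by (rule exp_ge_add_one_self)
  finally show ?thesis .
qed

text \<open>Revealing the coordinates one at a time turns the sum of the weights into a product-type
  martingale; the coefficients \<open>a\<close> carry the part of each weight that is already revealed.\<close>

lemma avoid_weight_mgf:
  fixes a :: "'j \<Rightarrow> real" and B :: "'j \<Rightarrow> 'a set"
  assumes "finite U" and J: "finite J" and p: "0 \<le> p" "p \<le> 1/2" and "D \<ge> 0" "M \<ge> 0"
    and lam: "\<bar>\<theta>\<bar> * (D * M) \<le> 1"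
    and "\<And>j. j \<in> J \<Longrightarrow> B j \<subseteq> U" and "\<And>j. j \<in> J \<Longrightarrow> 0 \<le> a j"
    and "\<And>j. j \<in> J \<Longrightarrow> a j / (1 - p) ^ card (B j) \<le> M"
    and "\<And>i. i \<in> U \<Longrightarrow> real (card {j\<in>J. i \<in> B j}) \<le> D"
  shows "measure_pmf.expectation (Pi_pmf U False (\<lambda>_. bernoulli_pmf p))
      (\<lambda>Y. exp (\<theta> * (\<Sum>j\<in>J. a j * avoid_weight p (B j) Y)))
    \<le> exp (\<theta> * (\<Sum>j\<in>J. a j) + 2 * \<theta>\<^sup>2 * p * D * M\<^sup>2 * (\<Sum>j\<in>J. real (card (B j))))"
  using assms(1,8-)
proof (induction U arbitrary: a B rule: finite_induct)
  case empty
  then show ?case by (simp add: avoid_weight_def)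
next
  case (insert x U a B)
  define B' where "B' j = B j - {x}" for j
  \<comment> \<open>The factor that the \<open>j\<close>-th weight contributes once coordinate
    \<open>x\<close> is revealed as \<open>y\<close>; it is absorbed into the coefficient
    \<open>a j\<close>.\<close>
  define c where "c y j = (if x \<in> B j then if y then 0 else 1 / (1 - p) else (1::real))" for y j
  define J' where "J' = {j\<in>J. x \<in> B j}"
  define S where "S = (\<Sum>j\<in>J'. a j)"
  define R where "R = 2 * \<theta>\<^sup>2 * p * D * M\<^sup>2 * (\<Sum>j\<in>J. real (card (B' j)))"
  have finB: "finite (B j)" if "j \<in> J" for j
    using insert.prems(1)[OF that] insert.hyps(1) finite_subset by blast
  have J'sub: "J' \<subseteq> J" "finite J'" using J by (auto simp: J'_def)
  have cardB: "card (B j) = card (B' j) + (if x \<in> B j then 1 else 0)" if "j \<in> J" for j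
    using finB[OF that] card_Suc_Diff1[of "B j" x] by (auto simp: B'_def)
  have w: "avoid_weight p (B j) (f(x := y)) = c y j * avoid_weight p (B' j) f" if "j \<in> J" for y j f
  proof -
    have "(\<forall>i\<in>B j. \<not> (f(x := y)) i) \<longleftrightarrow> (\<forall>i\<in>B' j. \<not> f i) \<and> (x \<in> B j \<longrightarrow> \<not> y)"
      by (auto simp: B'_def)
    then show ?thesis
      unfolding avoid_weight_def cardB[OF that] by (auto simp: c_def)
  qed
  have IH: "measure_pmf.expectation (Pi_pmf U False (\<lambda>_. bernoulli_pmf p))
      (\<lambda>f. exp (\<theta> * (\<Sum>j\<in>J. a j * avoid_weight p (B j) (f(x := y)))))
    \<le> exp (\<theta> * (\<Sum>j\<in>J. a j * c y j) + R)" for y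
  proof -
    have "measure_pmf.expectation (Pi_pmf U False (\<lambda>_. bernoulli_pmf p))
      (\<lambda>f. exp (\<theta> * (\<Sum>j\<in>J. (a j * c y j) * avoid_weight p (B' j) f)))
      \<le> exp (\<theta> * (\<Sum>j\<in>J. a j * c y j) + R)"
      unfolding R_def
    proof (rule insert.IH)
      fix j assume j: "j \<in> J"
      show "B' j \<subseteq> U" using insert.prems(1)[OF j] by (auto simp: B'_def)
      show "0 \<le> a j * c y j" using insert.prems(2)[OF j] p by (auto simp: c_def)
      \<comment> \<open>A coordinate revealed as \<open>False\<close> moves one factor
        \<open>1 / (1 - p)\<close> from the weight to its coefficient, so the quantity bounded by
        \<open>M\<close> does not grow.\<close>
      have "a j * c y j / (1 - p) ^ card (B' j) \<le> a j / (1 - p) ^ card (B j)"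
        using insert.prems(2)[OF j] p cardB[OF j] by (auto simp: c_def field_simps)
      then show "a j * c y j / (1 - p) ^ card (B' j) \<le> M" using insert.prems(3)[OF j] by linarith
    next
      fix i assume i: "i \<in> U"
      have "card {j\<in>J. i \<in> B' j} \<le> card {j\<in>J. i \<in> B j}"
        using J by (intro card_mono) (auto simp: B'_def)
      then show "real (card {j\<in>J. i \<in> B' j}) \<le> D" using insert.prems(4)[of i] i by simp
    qed
    moreover have "(\<Sum>j\<in>J. a j * avoid_weight p (B j) (f(x := y)))
        = (\<Sum>j\<in>J. (a j * c y j) * avoid_weight p (B' j) f)" for f
      using w by (intro sum.cong) auto
    ultimately show ?thesis by simp
  qed
  \<comment> \<open>Revealing \<open>x\<close> changes the sum of the coefficients by a mean-zero
    increment, of the shape treated in \<open>bernoulli_factor_mgf\<close>.\<close>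
  have split: "(\<Sum>j\<in>J. a j * c y j) = (\<Sum>j\<in>J. a j) + (if y then - S else S * p / (1 - p))" for y
  proof -
    have "(\<Sum>j\<in>J. a j * c y j) = (\<Sum>j\<in>J. a j + (if x \<in> B j then a j * (if y then -1 else p / (1 - p)) else 0))"
      using p by (intro sum.cong) (auto simp: c_def field_simps)
    also have "\<dots> = (\<Sum>j\<in>J. a j) + (\<Sum>j\<in>J'. a j * (if y then -1 else p / (1 - p)))"
      using J by (simp add: sum.distrib J'_def sum.inter_filter)
    also have "(\<Sum>j\<in>J'. a j * (if y then -1 else p / (1 - p))) = (if y then - S else S * p / (1 - p))"
      unfolding S_def by (auto simp: sum_negf sum_distrib_right sum_divide_distrib)
    finally show ?thesis .
  qed
  have aM: "a j \<le> M" if "j \<in> J" for j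
  proof -
    have "a j * 1 \<le> a j * (1 / (1 - p) ^ card (B j))"
      using insert.prems(2)[OF that] p by (intro mult_left_mono) (auto simp: power_le_one)
    then show ?thesis using insert.prems(3)[OF that] by simp
  qed
  have S0: "0 \<le> S" unfolding S_def using J'sub insert.prems(2) by (intro sum_nonneg) auto
  have S1: "S \<le> real (card J') * M"
    unfolding S_def using J'sub aM by (intro sum_bounded_above) auto
  have cD: "real (card J') \<le> D" using insert.prems(4)[of x] by (simp add: J'_def)
  have S2: "S \<le> D * M" using S1 mult_right_mono[OF cD \<open>0 \<le> M\<close>] by linarith
  have "\<bar>\<theta> * S\<bar> = \<bar>\<theta>\<bar> * S" using S0 by (simp add: abs_mult)
  also have "\<dots> \<le> \<bar>\<theta>\<bar> * (D * M)" using S2 by (intro mult_left_mono) auto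
  finally have lS: "\<bar>\<theta> * S\<bar> \<le> 1" using lam by linarith
  \<comment> \<open>One factor \<open>S\<close> is bounded by \<open>D * M\<close>, the other by
    \<open>card J' * M\<close>: the second form adds up over all coordinates to the sum of the
    \<open>card (B j)\<close>.\<close>
  have SS: "S\<^sup>2 \<le> D * M\<^sup>2 * real (card J')"
    using mult_mono[OF S2 S1] S0 \<open>0 \<le> D\<close> \<open>0 \<le> M\<close> by (simp add: power2_eq_square mult_ac)
  have "2 * p * (\<theta> * S)\<^sup>2 = 2 * \<theta>\<^sup>2 * p * S\<^sup>2" by (simp add: power_mult_distrib mult_ac)
  also have "\<dots> \<le> 2 * \<theta>\<^sup>2 * p * (D * M\<^sup>2 * real (card J'))"
    using SS p by (intro mult_left_mono) auto
  finally have quad: "2 * p * (\<theta> * S)\<^sup>2 \<le> 2 * \<theta>\<^sup>2 * p * D * M\<^sup>2 * real (card J')"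
    by (simp add: mult_ac)
  have cardsum: "(\<Sum>j\<in>J. real (card (B j))) = (\<Sum>j\<in>J. real (card (B' j))) + real (card J')"
  proof -
    have "(\<Sum>j\<in>J. real (card (B j))) = (\<Sum>j\<in>J. real (card (B' j)) + (if x \<in> B j then 1 else 0))"
      using cardB by (intro sum.cong) auto
    also have "\<dots> = (\<Sum>j\<in>J. real (card (B' j))) + (\<Sum>j\<in>J'. 1)"
      using J unfolding sum.distrib J'_def by (subst sum.inter_filter) auto
    finally show ?thesis by simp
  qed
  let ?A = "\<Sum>j\<in>J. a j"
  have "measure_pmf.expectation (Pi_pmf (insert x U) False (\<lambda>_. bernoulli_pmf p))
      (\<lambda>Y. exp (\<theta> * (\<Sum>j\<in>J. a j * avoid_weight p (B j) Y)))
    \<le> p * exp (\<theta> * (?A - S) + R) + (1 - p) * exp (\<theta> * (?A + S * p / (1 - p)) + R)"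
    using insert.hyps p IH[of True] IH[of False] split[of True] split[of False]
    by (subst expectation_Pi_bernoulli_insert) (auto intro!: add_mono mult_left_mono)
  also have "\<dots> = exp (\<theta> * ?A + R) * (p * exp (- (\<theta> * S)) + (1 - p) * exp ((\<theta> * S) * p / (1 - p)))"
    by (simp add: algebra_simps exp_add[symmetric] exp_diff[symmetric] flip: exp_minus)
  also have "\<dots> \<le> exp (\<theta> * ?A + R) * exp (2 * p * (\<theta> * S)\<^sup>2)"
    using bernoulli_factor_mgf[OF p lS] by (intro mult_left_mono) auto
  also have "\<dots> = exp (\<theta> * ?A + R + 2 * p * (\<theta> * S)\<^sup>2)" by (simp add: exp_add)
  also have "\<dots> \<le> exp (\<theta> * ?A + R + 2 * \<theta>\<^sup>2 * p * D * M\<^sup>2 * real (card J'))"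
    using quad by simp
  also have "\<dots> = exp (\<theta> * ?A + 2 * \<theta>\<^sup>2 * p * D * M\<^sup>2 * (\<Sum>j\<in>J. real (card (B j))))"
    by (simp add: R_def cardsum algebra_simps)
  finally show ?case .
qed

lemma avoid_weight_concentration:
  fixes B :: "'j \<Rightarrow> 'a set" and M :: real
  assumes U: "finite U" and J: "finite J" and p: "0 < p" "p \<le> 1/2" and D: "D > 0"
    and ps: "1 \<le> 8 * p * real s" and M: "M = 1 / (1 - p) ^ s"
    and B: "\<And>j. j \<in> J \<Longrightarrow> B j \<subseteq> U" "\<And>j. j \<in> J \<Longrightarrow> card (B j) \<le> s"
    and mult: "\<And>i. i \<in> U \<Longrightarrow> real (card {j\<in>J. i \<in> B j}) \<le> D"
  shows "measure_pmf.prob (Pi_pmf U False (\<lambda>_. bernoulli_pmf p))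
      {Y. \<bar>(\<Sum>j\<in>J. avoid_weight p (B j) Y) - real (card J)\<bar> \<ge> real (card J) / 2}
    \<le> 2 * exp (- (real (card J) / (32 * p * real s * D * M\<^sup>2)))"
proof -
  let ?P = "Pi_pmf U False (\<lambda>_. bernoulli_pmf p)"
  define m where "m = real (card J)"
  define Z where "Z Y = (\<Sum>j\<in>J. avoid_weight p (B j) Y)" for Y
  \<comment> \<open>Chernoff argument with \<open>\<theta> = l\<close> and
    \<open>\<theta> = - l\<close>. For this \<open>l\<close> the second-order term of
    \<open>avoid_weight_mgf\<close> is at most \<open>l / 4 * m\<close>, half of the gain
    \<open>l * m / 2\<close> from the deviation; \<open>ps\<close> keeps \<open>l * (D * M)\<close>
    at most 1.\<close>
  define l where "l = 1 / (8 * p * real s * D * M\<^sup>2)"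
  have s: "real s > 0" using ps p by (cases "s = 0") auto
  have M1: "M \<ge> 1" using p by (simp add: M power_le_one)
  have l: "l > 0" using s M1 p D by (simp add: l_def)
  have lDM: "l * (D * M) \<le> 1"
  proof -
    have "1 * 1 \<le> (8 * p * real s) * M" using ps M1 by (intro mult_mono) auto
    moreover have "l * (D * M) = 1 / ((8 * p * real s) * M)"
      using M1 D by (simp add: l_def power2_eq_square mult_ac)
    ultimately show ?thesis using p s M1 by (simp add: divide_le_eq_1)
  qed
  have fin: "finite (set_pmf ?P)" by (rule finite_set_Pi_pmf_bool[OF U])
  have mgf: "measure_pmf.expectation ?P (\<lambda>Y. exp (\<theta> * Z Y)) \<le> exp (\<theta> * m + l / 4 * m)"
    if lam: "\<bar>\<theta>\<bar> = l" for \<theta>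
  proof -
    have "measure_pmf.expectation ?P (\<lambda>Y. exp (\<theta> * (\<Sum>j\<in>J. 1 * avoid_weight p (B j) Y)))
      \<le> exp (\<theta> * (\<Sum>j\<in>J. 1) + 2 * \<theta>\<^sup>2 * p * D * M\<^sup>2 * (\<Sum>j\<in>J. real (card (B j))))"
    proof (rule avoid_weight_mgf[OF U J])
      fix j assume j: "j \<in> J"
      show "1 / (1 - p) ^ card (B j) \<le> M"
        unfolding M using p B(2)[OF j] by (intro divide_left_mono power_decreasing) auto
    qed (use p D M1 lam lDM B mult in auto)
    then have "measure_pmf.expectation ?P (\<lambda>Y. exp (\<theta> * Z Y))
      \<le> exp (\<theta> * m + 2 * \<theta>\<^sup>2 * p * D * M\<^sup>2 * (\<Sum>j\<in>J. real (card (B j))))"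
      by (simp add: Z_def m_def)
    also have "2 * \<theta>\<^sup>2 * p * D * M\<^sup>2 * (\<Sum>j\<in>J. real (card (B j))) \<le> 2 * \<theta>\<^sup>2 * p * D * M\<^sup>2 * (m * real s)"
      unfolding m_def using p D B(2) by (intro mult_left_mono sum_bounded_above) auto
    also have "2 * \<theta>\<^sup>2 * p * D * M\<^sup>2 * (m * real s) = l / 4 * m"
    proof -
      have "\<theta>\<^sup>2 = l\<^sup>2" using lam by (metis power2_abs)
      then show ?thesis using p D M1 s by (simp add: l_def power2_eq_square)
    qed
    finally show ?thesis by simp
  qed
  have markov: "measure_pmf.prob ?P {Y. \<theta> * Z Y \<ge> \<theta> * m + l * m / 2} \<le> exp (- (l / 4 * m))"
    if lam: "\<bar>\<theta>\<bar> = l" for \<theta>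
  proof -
    have "measure_pmf.prob ?P {Y \<in> space ?P. exp (\<theta> * Z Y) \<ge> exp (\<theta> * m + l * m / 2)}
      \<le> measure_pmf.expectation ?P (\<lambda>Y. exp (\<theta> * Z Y)) / exp (\<theta> * m + l * m / 2)"
      by (rule integral_Markov_inequality_measure[where A = "{}"])
         (auto intro: integrable_measure_pmf_finite[OF fin])
    also have "\<dots> \<le> exp (\<theta> * m + l / 4 * m) / exp (\<theta> * m + l * m / 2)"
      using mgf[OF lam] by (intro divide_right_mono) auto
    also have "\<dots> = exp (- (l / 4 * m))"
      by (simp flip: exp_diff)
    finally show ?thesis by simp
  qed
  have "measure_pmf.prob ?P {Y. \<bar>Z Y - m\<bar> \<ge> m / 2}
    \<le> measure_pmf.prob ?P ({Y. l * Z Y \<ge> l * m + l * m / 2} \<union> {Y. (-l) * Z Y \<ge> (-l) * m + l * m / 2})"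
  proof (rule measure_pmf.finite_measure_mono)
    show "{Y. \<bar>Z Y - m\<bar> \<ge> m / 2} \<subseteq> {Y. l * Z Y \<ge> l * m + l * m / 2} \<union> {Y. (-l) * Z Y \<ge> (-l) * m + l * m / 2}"
    proof
      fix Y assume "Y \<in> {Y. \<bar>Z Y - m\<bar> \<ge> m / 2}"
      then have "l * (m / 2) \<le> l * (Z Y - m) \<or> l * (m / 2) \<le> l * (m - Z Y)"
        using l by (auto simp: abs_real_def split: if_splits)
      then show "Y \<in> {Y. l * Z Y \<ge> l * m + l * m / 2} \<union> {Y. (-l) * Z Y \<ge> (-l) * m + l * m / 2}"
        by (auto simp: algebra_simps)
    qed
  qed auto
  also have "\<dots> \<le> measure_pmf.prob ?P {Y. l * Z Y \<ge> l * m + l * m / 2} +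
      measure_pmf.prob ?P {Y. (-l) * Z Y \<ge> (-l) * m + l * m / 2}"
    by (rule measure_Un_le) auto
  also have "\<dots> \<le> 2 * exp (- (l / 4 * m))"
    using markov[of l] markov[of "-l"] l by simp
  also have "l / 4 * m = m / (32 * p * real s * D * M\<^sup>2)" by (simp add: l_def)
  finally show ?thesis by (simp add: Z_def m_def)
qed

text \<open>Lets a sum over the classes of a fixed \<open>u\<close> be replaced by one over these
  classes without \<open>u\<close>. Since \<open>u\<close> lies in all of them, its multiplicity
  would otherwise be the number of classes and ruin the concentration.\<close>

lemma avoid_weight_remove:
  assumes "u \<in> B" "finite B" "\<not> Y u"
  shows "avoid_weight p B Y = avoid_weight p (B - {u}) Y / (1 - p)"
proof -
  have "card B = Suc (card (B - {u}))" using assms by (simp add: card_Suc_Diff1 del: card_Diff_insert)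
  moreover have "(\<forall>i\<in>B. \<not> Y i) \<longleftrightarrow> (\<forall>i\<in>B - {u}. \<not> Y i)" using assms by auto
  ultimately show ?thesis by (simp add: avoid_weight_def)
qed

lemma avoid_weight_eq_0: "u \<in> B \<Longrightarrow> Y u \<Longrightarrow> avoid_weight p B Y = 0"
  by (auto simp: avoid_weight_def)

section \<open>Choices with small potential\<close>

lemma averaging_exists:
  fixes w F :: "'x \<Rightarrow> real"
  assumes "finite X" "\<And>x. x \<in> X \<Longrightarrow> 0 \<le> w x" "(\<Sum>x\<in>X. w x) = 1" "(\<Sum>x\<in>X. w x * F x) < 1"
  shows "\<exists>x\<in>X. 0 < w x \<and> F x < 1"
proof (rule ccontr)
  assume "\<not> ?thesis"
  then have "w x * 1 \<le> w x * F x" if "x \<in> X" for x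
    using that assms(2)[of x] by (cases "w x = 0") (auto simp: not_less)
  then have "(\<Sum>x\<in>X. w x) \<le> (\<Sum>x\<in>X. w x * F x)" by (intro sum_mono) auto
  then show False using assms(3,4) by linarith
qed

text \<open>Method of conditional expectations. The sum in \<open>pot\<close> is the expected
  potential when the choices are made independently with the weights \<open>w t\<close>; fixing the
  last choice at a suitable value keeps it below 1, and the factor so fixed moves into
  \<open>c\<close>. Positive weight is recorded because it certifies that a choice is
  allowed.\<close>

lemma exists_choice_product_potential:
  fixes w :: "nat \<Rightarrow> 'x \<Rightarrow> real" and f :: "'i \<Rightarrow> nat \<Rightarrow> 'x \<Rightarrow> real"
  assumes X: "finite X" "\<And>t x. t < T \<Longrightarrow> x \<in> X \<Longrightarrow> 0 \<le> w t x"
    "\<And>t. t < T \<Longrightarrow> (\<Sum>x\<in>X. w t x) = 1"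
    and pot: "(\<Sum>i\<in>I. c i * (\<Prod>t<T. \<Sum>x\<in>X. w t x * f i t x)) < 1"
  shows "\<exists>\<phi>. (\<forall>t<T. \<phi> t \<in> X \<and> 0 < w t (\<phi> t)) \<and> (\<Sum>i\<in>I. c i * (\<Prod>t<T. f i t (\<phi> t))) < 1"
  using X(2,3) pot
proof (induction T arbitrary: c)
  case 0
  then show ?case by simp
next
  case (Suc T)
  let ?g = "\<lambda>i. \<Prod>t<T. \<Sum>x\<in>X. w t x * f i t x"
  have "(\<Sum>x\<in>X. w T x * (\<Sum>i\<in>I. c i * f i T x * ?g i))
      = (\<Sum>i\<in>I. \<Sum>x\<in>X. w T x * (c i * f i T x * ?g i))"
    unfolding sum_distrib_left by (rule sum.swap)
  also have "\<dots> = (\<Sum>i\<in>I. c i * (\<Prod>t<Suc T. \<Sum>x\<in>X. w t x * f i t x))"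
    by (intro sum.cong) (simp_all add: sum_distrib_left sum_distrib_right mult_ac)
  also have "\<dots> < 1" by (rule Suc.prems)
  finally obtain x where x: "x \<in> X" "0 < w T x" "(\<Sum>i\<in>I. c i * f i T x * ?g i) < 1"
    using averaging_exists[OF X(1), of "w T" "\<lambda>x. \<Sum>i\<in>I. c i * f i T x * ?g i"] Suc.prems(1,2)
    by auto
  obtain \<phi> where \<phi>: "\<forall>t<T. \<phi> t \<in> X \<and> 0 < w t (\<phi> t)"
    "(\<Sum>i\<in>I. c i * f i T x * (\<Prod>t<T. f i t (\<phi> t))) < 1"
    using Suc.IH[of "\<lambda>i. c i * f i T x"] Suc.prems(1,2) x(3) by auto
  have "(\<Sum>i\<in>I. c i * (\<Prod>t<Suc T. f i t ((\<phi>(T := x)) t)))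
      = (\<Sum>i\<in>I. c i * f i T x * (\<Prod>t<T. f i t (\<phi> t)))"
    by (intro sum.cong) (auto simp: mult_ac)
  then show ?case using \<phi> x by (intro exI[of _ "\<phi>(T := x)"]) (auto simp: less_Suc_eq)
qed

lemma sum_weights_with_marked_choice:
  fixes w :: "nat \<Rightarrow> real" and k :: nat
  assumes "(\<Sum>x\<le>k. w x) = 1" "P \<subseteq> {..k}"
  shows "(\<Sum>x\<le>k. w x * (if x \<in> P then a else 1)) = 1 + (a - 1) * (\<Sum>x\<in>P. w x)"
proof -
  have "(\<Sum>x\<le>k. w x * (if x \<in> P then a else 1)) = (\<Sum>x\<le>k. w x + (if x \<in> P then (a - 1) * w x else 0))"
    by (intro sum.cong) (auto simp: algebra_simps)
  also have "\<dots> = 1 + (\<Sum>x\<in>P. (a - 1) * w x)"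
    using assms by (simp add: sum.distrib sum.inter_restrict[symmetric] Int_absorb1)
  finally show ?thesis by (simp add: sum_distrib_left)
qed

lemma prod_marked_choices:
  fixes a :: real and T :: nat
  shows "(\<Prod>t<T. if Q t then a else 1) = a ^ card {t. t < T \<and> Q t}"
proof -
  have "(\<Prod>t<T. if Q t then a else 1) = (\<Prod>t\<in>{t\<in>{..<T}. Q t}. a)"
    by (rule prod.inter_filter[symmetric]) simp
  then show ?thesis by simp
qed

lemma prod_le_exp_sum:
  fixes q :: "nat \<Rightarrow> real"
  assumes "\<And>t. t < T \<Longrightarrow> 0 \<le> 1 + b * q t"
  shows "(\<Prod>t<T. 1 + b * q t) \<le> exp (b * (\<Sum>t<T. q t))"
proof -
  have "(\<Prod>t<T. 1 + b * q t) \<le> (\<Prod>t<T. exp (b * q t))"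
    using assms by (intro prod_mono) auto
  also have "\<dots> = exp (b * (\<Sum>t<T. q t))" by (simp add: exp_sum sum_distrib_left)
  finally show ?thesis .
qed

section \<open>Extending a family of colourings by one vertex\<close>

text \<open>\<open>ks_ge\<close> keeps full classes rare, \<open>T_ge\<close> makes
  \<open>T / (80 * k)\<close> at least \<open>3 * ln n\<close>, and \<open>spread\<close> makes the
  failure probability of each concentration statement at most \<open>2 / n ^ 6\<close>.\<close>

locale colouring_parameters =
  fixes n k s T :: nat and p :: real
  assumes p_pos: "0 < p" and p_le: "p \<le> 1/2"
    and n_ge: "2 \<le> n" and s_ge: "2 \<le> s"
    and ks_ge: "160 * real n \<le> real k * real s"
    and T_ge: "240 * real k * ln (real n) \<le> real T"
    and ps_ge: "1 \<le> 8 * p * real s"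
    and spread: "6 * ln (real n) \<le> real k / (2560 * p * real s * (1 / (1 - p) ^ s)\<^sup>2)"
begin

text \<open>A colouring \<open>col t\<close> has the classes \<open>0, \<dots>, k - 1\<close>; a colour \<open>col t u \<ge> k\<close> means that \<open>u\<close> is
  in no class, and will be replaced by a colour of its own.\<close>

definition shared :: "(nat \<Rightarrow> nat \<Rightarrow> nat) \<Rightarrow> nat \<Rightarrow> nat \<Rightarrow> nat set" where
  "shared col u w = {t. t < T \<and> col t u < k \<and> col t u = col t w}"

definition cls :: "(nat \<Rightarrow> nat \<Rightarrow> nat) \<Rightarrow> nat \<Rightarrow> nat \<Rightarrow> nat \<Rightarrow> nat set" where
  "cls col v t c = {u. u < v \<and> col t u = c}"

text \<open>Invariant after the vertices below \<open>v\<close> are coloured. The bound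
  \<open>4 * T / k\<close> controls the multiplicity in the sums over the classes of one vertex, and
  \<open>T / 10\<close> guarantees that such a sum has enough terms.\<close>

definition admissible :: "nat \<Rightarrow> (nat set \<Rightarrow> bool) \<Rightarrow> (nat \<Rightarrow> nat \<Rightarrow> nat) \<Rightarrow> bool" where
  "admissible v X col \<longleftrightarrow>
     (\<forall>w<v. \<forall>u<w. (X {u, w} \<longleftrightarrow> shared col u w = {}) \<and>
        real (card (shared col u w)) \<le> 4 * real T / real k) \<and>
     (\<forall>u<v. real T / 10 \<le> real (card {t. t < T \<and> col t u < k})) \<and>
     (\<forall>t<T. \<forall>c<k. card (cls col v t c) \<le> s)"

definition open_times :: "(nat \<Rightarrow> nat \<Rightarrow> nat) \<Rightarrow> nat \<Rightarrow> nat \<Rightarrow> nat set" where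
  "open_times col v u = {t. t < T \<and> col t u < k \<and> card (cls col v t (col t u)) < s}"

definition open_classes :: "(nat \<Rightarrow> nat \<Rightarrow> nat) \<Rightarrow> nat \<Rightarrow> nat \<Rightarrow> nat set" where
  "open_classes col v t = {c. c < k \<and> card (cls col v t c) < s}"

text \<open>\<open>Y\<close> stands for the neighbourhood of the new vertex \<open>v\<close> among
  its predecessors. Under random \<open>Y\<close> each of the sums has its number of terms as
  expectation.\<close>

definition typical :: "nat \<Rightarrow> (nat \<Rightarrow> nat \<Rightarrow> nat) \<Rightarrow> (nat \<Rightarrow> bool) \<Rightarrow> bool" where
  "typical v col Y \<longleftrightarrow>
     (\<forall>u<v. \<bar>(\<Sum>t\<in>open_times col v u. avoid_weight p (cls col v t (col t u) - {u}) Y)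
              - real (card (open_times col v u))\<bar> < real (card (open_times col v u)) / 2) \<and>
     (\<forall>t<T. \<bar>(\<Sum>c\<in>open_classes col v t. avoid_weight p (cls col v t c) Y)
              - real (card (open_classes col v t))\<bar> < real (card (open_classes col v t)) / 2)"

section \<open>Room left in the classes\<close>

lemma k_pos: "0 < k"
proof (rule ccontr)
  assume "\<not> 0 < k"
  then show False using ks_ge n_ge by simp
qed

lemma ln_n_pos: "1/2 \<le> ln (real n)"
proof -
  have "ln 2 \<le> ln (real n)" using n_ge by simp
  then show ?thesis using ln2_ge_two_thirds by linarith
qed

lemma T_large: "100 \<le> real T"
proof -
  have "240 * 1 * (1/2) \<le> 240 * real k * ln (real n)"
    using k_pos ln_n_pos by (intro mult_mono) auto
  then show ?thesis using T_ge by linarith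
qed

lemma finite_sets [simp]:
  "finite (cls col v t c)" "finite (shared col u w)"
  "finite (open_times col v u)" "finite (open_classes col v t)"
  by (auto simp: cls_def shared_def open_times_def open_classes_def)

lemma shared_sym: "shared col u w = shared col w u"
  by (auto simp: shared_def)

lemma card_shared_le:
  assumes "admissible v X col" "u < v" "w < v" "u \<noteq> w"
  shows "real (card (shared col u w)) \<le> 4 * real T / real k"
proof -
  have "real (card (shared col u w)) \<le> 4 * real T / real k" if "w < v" "u < w" for u w
    using assms(1) that unfolding admissible_def by blast
  then show ?thesis using assms shared_sym[of col u w] by (metis linorder_neqE_nat)
qed

text \<open>Full classes of one colouring are disjoint and have at least \<open>s\<close> elements,
  so there are at most \<open>n / s \<le> k / 160\<close> of them.\<close>

lemma card_open_classes_ge: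
  assumes "v \<le> n"
  shows "159 / 160 * real k \<le> real (card (open_classes col v t))"
proof -
  define K where "K = {c. c < k \<and> s \<le> card (cls col v t c)}"
  have K: "finite K" by (simp add: K_def)
  have "card K * s = (\<Sum>c\<in>K. s)" by simp
  also have "\<dots> \<le> (\<Sum>c\<in>K. card (cls col v t c))" by (intro sum_mono) (auto simp: K_def)
  also have "\<dots> = card (\<Union>c\<in>K. cls col v t c)"
    using K by (intro card_UN_disjoint[symmetric]) (auto simp: cls_def)
  also have "\<dots> \<le> card {..<v}" by (intro card_mono) (auto simp: cls_def)
  finally have "card K * s \<le> n" using assms by simp
  then have "real (card K) * real s \<le> real n" by (metis of_nat_le_iff of_nat_mult)
  then have "(160 * real (card K)) * real s \<le> real k * real s" using ks_ge by linarith
  then have "160 * real (card K) \<le> real k" using s_ge by simp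
  moreover have "card {..<k} \<le> card (open_classes col v t) + card K"
    using card_mono[of "open_classes col v t \<union> K" "{..<k}"]
      card_Un_le[of "open_classes col v t" K] K
    by (force simp: open_classes_def K_def)
  ultimately show ?thesis by simp
qed

text \<open>Double counting of pairs of a time at which the class of \<open>u\<close> is full and
  another vertex of that class: each such time gives at least \<open>s - 1\<close> vertices, and
  each vertex occurs at most \<open>4 * T / k\<close> times. With \<open>s - 1 \<ge> s / 2\<close>
  this excludes at most \<open>T / 20\<close> of the at least \<open>T / 10\<close> times granted by
  the invariant.\<close>

lemma card_open_times_ge:
  assumes adm: "admissible v X col" and u: "u < v" and v: "v \<le> n"
  shows "real T / 20 \<le> real (card (open_times col v u))"
proof -
  define K where "K = {t. t < T \<and> col t u < k \<and> s \<le> card (cls col v t (col t u))}"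
  have K: "finite K" by (simp add: K_def)
  have "card K * (s - 1) = (\<Sum>t\<in>K. s - 1)" by simp
  also have "\<dots> \<le> (\<Sum>t\<in>K. card (cls col v t (col t u) - {u}))"
  proof (rule sum_mono)
    fix t assume "t \<in> K"
    then show "s - 1 \<le> card (cls col v t (col t u) - {u})"
      using u by (subst card_Diff_singleton) (auto simp: K_def cls_def)
  qed
  also have "\<dots> = (\<Sum>t\<in>K. \<Sum>w\<in>{..<v} - {u}. if col t w = col t u then 1 else 0)"
  proof (rule sum.cong[OF refl])
    fix t
    have "cls col v t (col t u) - {u} = {w \<in> {..<v} - {u}. col t w = col t u}"
      by (auto simp: cls_def)
    then show "card (cls col v t (col t u) - {u}) = (\<Sum>w\<in>{..<v} - {u}. if col t w = col t u then 1 else 0)"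
      by (simp add: sum.inter_filter[symmetric])
  qed
  also have "\<dots> = (\<Sum>w\<in>{..<v} - {u}. \<Sum>t\<in>K. if col t w = col t u then 1 else 0)"
    by (rule sum.swap)
  also have "\<dots> \<le> (\<Sum>w\<in>{..<v} - {u}. card (shared col u w))"
  proof (rule sum_mono)
    fix w
    have "(\<Sum>t\<in>K. if col t w = col t u then 1 else (0::nat)) = card {t\<in>K. col t w = col t u}"
      using K by (simp add: sum.inter_filter[symmetric])
    also have "\<dots> \<le> card (shared col u w)"
      by (intro card_mono) (auto simp: K_def shared_def)
    finally show "(\<Sum>t\<in>K. if col t w = col t u then 1 else (0::nat)) \<le> card (shared col u w)" .
  qed
  finally have "real (card K * (s - 1)) \<le> real (\<Sum>w\<in>{..<v} - {u}. card (shared col u w))"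
    by (simp only: of_nat_le_iff)
  also have "\<dots> = (\<Sum>w\<in>{..<v} - {u}. real (card (shared col u w)))" by simp
  also have "\<dots> \<le> (\<Sum>w\<in>{..<v} - {u}. 4 * real T / real k)"
    using card_shared_le[OF adm u] by (intro sum_mono) auto
  also have "\<dots> \<le> real n * (4 * real T / real k)"
    using u v by (auto intro!: mult_right_mono divide_right_mono)
  finally have 1: "real (card K) * (real s - 1) \<le> real n * (4 * real T / real k)"
    using s_ge by (simp add: of_nat_diff)
  have "real (card K) * (real s / 2) \<le> real (card K) * (real s - 1)"
    using s_ge by (intro mult_left_mono) auto
  also note 1
  also have "real n * (4 * real T / real k) = (8 * real n * real T / real k) / 2" by simp
  finally have "real (card K) * real s \<le> 8 * real n * real T / real k" by (simp add: mult_ac)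
  then have "real (card K) * real s * (20 * real k) \<le> 8 * real n * real T / real k * (20 * real k)"
    by (intro mult_right_mono) auto
  also have "\<dots> = (160 * real n) * real T" using k_pos by simp
  also have "\<dots> \<le> (real k * real s) * real T" using ks_ge by (intro mult_right_mono) auto
  finally have "(20 * real (card K)) * (real k * real s) \<le> real T * (real k * real s)"
    by (simp add: mult_ac)
  then have "20 * real (card K) \<le> real T" using k_pos s_ge by simp
  moreover have "real T / 10 \<le> real (card {t. t < T \<and> col t u < k})"
    using adm u by (simp add: admissible_def)
  moreover have "card {t. t < T \<and> col t u < k} \<le> card (open_times col v u) + card K"
    using card_mono[of "open_times col v u \<union> K" "{t. t < T \<and> col t u < k}"]
      card_Un_le[of "open_times col v u" K] K
    by (force simp: open_times_def K_def)
  ultimately show ?thesis by linarith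
qed

text \<open>The choice weights \<open>a t c\<close> carry the factor \<open>1 / (1 - p) ^ card c\<close>, the inverse of the probability
  that the neighbourhood avoids the class, so that every open class has the same average weight.\<close>

lemma admissible_extend:
  assumes adm: "admissible v X col" and v: "v < n" and tp: "typical v col (\<lambda>u. X {u, v})"
  shows "\<exists>col'. admissible (Suc v) X col'"
proof -
  define Y where "Y u = X {u, v}" for u
  define a where "a t c = avoid_weight p (cls col v t c) Y / (2 * real k)" for t c
  define W where "W t = (\<Sum>c\<in>open_classes col v t. a t c)" for t
  \<comment> \<open>Colour \<open>k\<close> means joining no class. The divisor \<open>2 * k\<close>
    in \<open>a\<close> leaves it nonnegative weight: typicality bounds the sum of the
    \<open>avoid_weight\<close> terms by \<open>3 / 2 * k\<close>.\<close>
  define w where "w t x = (if x < k then if x \<in> open_classes col v t then a t x else 0 else 1 - W t)" for t x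
  \<comment> \<open>The probability that \<open>v\<close> enters the class of \<open>u\<close> in
    colouring \<open>t\<close>.\<close>
  define q where "q u t = (if t \<in> open_times col v u then a t (col t u) else 0)" for u t
  have p1: "p < 1" using p_le by simp
  have a_nonneg: "0 \<le> a t c" for t c
    unfolding a_def by (intro divide_nonneg_nonneg avoid_weight_nonneg[OF p1]) auto
  have W_bounds: "159 / 640 \<le> W t" "W t \<le> 1" if "t < T" for t
  proof -
    let ?m = "real (card (open_classes col v t))"
    let ?Z = "\<Sum>c\<in>open_classes col v t. avoid_weight p (cls col v t c) Y"
    have m1: "159 / 160 * real k \<le> ?m" using card_open_classes_ge v by simp
    have "card (open_classes col v t) \<le> card {..<k}"
      by (intro card_mono) (auto simp: open_classes_def)
    then have m2: "?m \<le> real k" by simp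
    have "\<bar>?Z - ?m\<bar> < ?m / 2" using tp that unfolding typical_def Y_def by blast
    then have Z: "?m / 2 \<le> ?Z" "?Z \<le> 3 / 2 * ?m" by linarith+
    have WZ: "W t = ?Z / (2 * real k)" by (simp add: W_def a_def sum_divide_distrib)
    show "159 / 640 \<le> W t" "W t \<le> 1"
      unfolding WZ using Z m1 m2 k_pos by (simp_all add: field_simps)
  qed
  have w_nonneg: "0 \<le> w t x" if "t < T" for t x
    using W_bounds[OF that] a_nonneg by (simp add: w_def)
  have W_eq: "W t = (\<Sum>x<k. w t x)" for t
  proof -
    have "(\<Sum>x<k. w t x) = (\<Sum>x<k. if x \<in> open_classes col v t then a t x else 0)"
      by (intro sum.cong) (auto simp: w_def)
    also have "\<dots> = sum (a t) ({..<k} \<inter> open_classes col v t)" by (simp add: sum.inter_restrict)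
    also have "{..<k} \<inter> open_classes col v t = open_classes col v t" by (auto simp: open_classes_def)
    finally show ?thesis by (simp add: W_def)
  qed
  have w_sum: "(\<Sum>x\<le>k. w t x) = 1" for t
    using W_eq[of t] by (simp add: w_def flip: lessThan_Suc_atMost)
  have q_eq: "q u t = (\<Sum>x\<in>{x. x < k \<and> x = col t u}. w t x)" if "t < T" for u t
  proof (cases "col t u < k")
    case True
    then have eq: "{x. x < k \<and> x = col t u} = {col t u}" by auto
    show ?thesis unfolding eq using True that by (simp add: q_def w_def open_times_def open_classes_def)
  next
    case False
    then have eq: "{x. x < k \<and> x = col t u} = {}" by auto
    show ?thesis unfolding eq using False by (simp add: q_def open_times_def)
  qed
  have q_le1: "0 \<le> q u t" "q u t \<le> 1" if "t < T" for u t
  proof -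
    show "0 \<le> q u t" using a_nonneg by (simp add: q_def)
    have "(\<Sum>x\<in>{x. x < k \<and> x = col t u}. w t x) \<le> (\<Sum>x\<le>k. w t x)"
      using w_nonneg[OF that] by (intro sum_mono2) auto
    then show "q u t \<le> 1" using q_eq[OF that] w_sum by simp
  qed
  have q_sum: "(\<Sum>t<T. q u t) = (\<Sum>t\<in>open_times col v u. avoid_weight p (cls col v t (col t u)) Y) / (2 * real k)"
    for u
  proof -
    have "(\<Sum>t<T. q u t) = (\<Sum>t\<in>{..<T} \<inter> open_times col v u. a t (col t u))"
      by (simp add: q_def sum.inter_restrict)
    also have "{..<T} \<inter> open_times col v u = open_times col v u" by (auto simp: open_times_def)
    finally show ?thesis by (simp add: a_def sum_divide_distrib)
  qed
  have q_sum_adj: "(\<Sum>t<T. q u t) = 0" if "u < v" "Y u" for u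
    unfolding q_sum using that by (simp add: avoid_weight_eq_0[of u] cls_def)
  have q_sum_bounds: "real T / (80 * real k) \<le> (\<Sum>t<T. q u t)" "(\<Sum>t<T. q u t) \<le> 3 * real T / (2 * real k)"
    if u: "u < v" "\<not> Y u" for u
  proof -
    let ?m = "real (card (open_times col v u))"
    define Z where "Z = (\<Sum>t\<in>open_times col v u. avoid_weight p (cls col v t (col t u) - {u}) Y)"
    have m1: "real T / 20 \<le> ?m" using card_open_times_ge[OF adm u(1)] v by simp
    have "card (open_times col v u) \<le> card {..<T}"
      by (intro card_mono) (auto simp: open_times_def)
    then have m2: "?m \<le> real T" by simp
    have "\<bar>Z - ?m\<bar> < ?m / 2" using tp u unfolding typical_def Y_def Z_def by blast
    then have Z: "?m / 2 \<le> Z" "Z \<le> 3 / 2 * ?m" by linarith+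
    \<comment> \<open>Typicality speaks of the classes without \<open>u\<close>; putting the
      nonneighbour \<open>u\<close> back multiplies the sum by \<open>1 / (1 - p)\<close>, which is
      between 1 and 2.\<close>
    have "(\<Sum>t\<in>open_times col v u. avoid_weight p (cls col v t (col t u)) Y) = Z / (1 - p)"
      unfolding Z_def sum_divide_distrib
      using u by (intro sum.cong refl avoid_weight_remove) (auto simp: cls_def)
    then have eq: "(\<Sum>t<T. q u t) = Z / (1 - p) / (2 * real k)" by (simp add: q_sum)
    have Z0: "0 \<le> Z" using Z(1) by (meson dual_order.trans of_nat_0_le_iff divide_nonneg_nonneg zero_le_numeral)
    have "Z * (1 - p) \<le> Z * 1" using Z0 p_pos by (intro mult_left_mono) auto
    then have l: "Z \<le> Z / (1 - p)" using p1 by (simp add: pos_le_divide_eq)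
    have "Z * 1 \<le> Z * (2 * (1 - p))" using Z0 p_le by (intro mult_left_mono) auto
    then have r: "Z / (1 - p) \<le> 2 * Z" using p1 by (simp add: pos_divide_le_eq mult_ac)
    have "real T / (80 * real k) = (real T / 40) / (2 * real k)" by simp
    also have "\<dots> \<le> Z / (1 - p) / (2 * real k)"
    proof (rule divide_right_mono)
      show "real T / 40 \<le> Z / (1 - p)" using l Z m1 by linarith
    qed simp
    finally show "real T / (80 * real k) \<le> (\<Sum>t<T. q u t)" using eq by simp
    have "Z / (1 - p) / (2 * real k) \<le> (3 * real T) / (2 * real k)"
    proof (rule divide_right_mono)
      show "Z / (1 - p) \<le> 3 * real T" using r Z m2 by linarith
    qed simp
    then show "(\<Sum>t<T. q u t) \<le> 3 * real T / (2 * real k)" using eq by simp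
  qed
  \<comment> \<open>The potential has a term for each requirement on the choice: a nonneighbour
    \<open>u\<close> shares some class with \<open>v\<close>, no \<open>u\<close> shares more than
    \<open>4 * T / k\<close> classes with \<open>v\<close>, and \<open>v\<close> is in at least
    \<open>T / 10\<close> classes. A violated requirement makes its term at least 1.\<close>
  define I where "I = {..<v} <+> ({..<v} <+> {()})"
  define c where "c = case_sum (\<lambda>u. if Y u then 0 else 1)
    (case_sum (\<lambda>u::nat. exp (- (4 * real T / real k))) (\<lambda>_::unit. exp (real T / 10)))"
  define f where "f = case_sum (\<lambda>u t x. if x \<in> {x. x < k \<and> x = col t u} then 0 else (1::real))
    (case_sum (\<lambda>u t x. if x \<in> {x. x < k \<and> x = col t u} then exp 1 else 1)
      (\<lambda>(_::unit) t x. if x \<in> {..<k} then exp (-1) else 1))"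
  have ex: "exp (- (3 * ln (real n))) = 1 / real n ^ 3"
  proof -
    have "exp (3 * ln (real n)) = real n ^ 3"
      using n_ge by (simp add: exp_of_nat_mult[of 3, simplified])
    then show ?thesis by (simp add: exp_minus field_simps)
  qed
  have Tk: "3 * ln (real n) \<le> real T / (80 * real k)" "3 * ln (real n) \<le> real T / real k"
  proof -
    show "3 * ln (real n) \<le> real T / (80 * real k)" using T_ge k_pos by (simp add: field_simps)
    also have "\<dots> \<le> real T / real k" using k_pos by (intro divide_left_mono) auto
    finally show "3 * ln (real n) \<le> real T / real k" .
  qed
  have pot1: "c (Inl u) * (\<Prod>t<T. \<Sum>x\<le>k. w t x * f (Inl u) t x) \<le> 1 / real n ^ 3" if u: "u < v" for u
  proof (cases "Y u")
    case False
    have "(\<Prod>t<T. \<Sum>x\<le>k. w t x * f (Inl u) t x) = (\<Prod>t<T. 1 + (-1) * q u t)"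
    proof (rule prod.cong[OF refl])
      fix t assume t: "t \<in> {..<T}"
      have "(\<Sum>x\<le>k. w t x * f (Inl u) t x) = 1 + (0 - 1) * (\<Sum>x\<in>{x. x < k \<and> x = col t u}. w t x)"
        unfolding f_def sum.case by (rule sum_weights_with_marked_choice[OF w_sum]) auto
      then show "(\<Sum>x\<le>k. w t x * f (Inl u) t x) = 1 + (-1) * q u t" using q_eq t by simp
    qed
    also have "\<dots> \<le> exp ((-1) * (\<Sum>t<T. q u t))"
      by (rule prod_le_exp_sum) (use q_le1 in auto)
    also have "\<dots> \<le> exp (- (3 * ln (real n)))" using q_sum_bounds(1)[OF u False] Tk by simp
    finally show ?thesis using False by (simp add: c_def ex)
  qed (simp add: c_def)
  have pot2: "c (Inr (Inl u)) * (\<Prod>t<T. \<Sum>x\<le>k. w t x * f (Inr (Inl u)) t x) \<le> 1 / real n ^ 3" if u: "u < v" for u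
  proof -
    have Sq: "(\<Sum>t<T. q u t) \<le> 3 * real T / (2 * real k)"
    proof (cases "Y u")
      case True then show ?thesis using q_sum_adj[OF u] by simp
    qed (use q_sum_bounds(2)[OF u] in auto)
    have "(\<Prod>t<T. \<Sum>x\<le>k. w t x * f (Inr (Inl u)) t x) = (\<Prod>t<T. 1 + (exp 1 - 1) * q u t)"
    proof (rule prod.cong[OF refl])
      fix t assume t: "t \<in> {..<T}"
      have "(\<Sum>x\<le>k. w t x * f (Inr (Inl u)) t x) = 1 + (exp 1 - 1) * (\<Sum>x\<in>{x. x < k \<and> x = col t u}. w t x)"
        unfolding f_def sum.case by (rule sum_weights_with_marked_choice[OF w_sum]) auto
      then show "(\<Sum>x\<le>k. w t x * f (Inr (Inl u)) t x) = 1 + (exp 1 - 1) * q u t" using q_eq t by simp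
    qed
    also have "\<dots> \<le> exp ((exp 1 - 1) * (\<Sum>t<T. q u t))"
      by (rule prod_le_exp_sum) (use q_le1 in auto)
    \<comment> \<open>Since \<open>exp 1 - 1 \<le> 2\<close>, the exponent is at most
      \<open>3 * T / k\<close>, and the prefactor with exponent \<open>- 4 * T / k\<close> outweighs
      it by \<open>T / k\<close>.\<close>
    also have "(exp 1 - 1) * (\<Sum>t<T. q u t) \<le> 2 * (3 * real T / (2 * real k))"
      using exp_le Sq q_le1 by (intro mult_mono sum_nonneg) auto
    finally have "c (Inr (Inl u)) * (\<Prod>t<T. \<Sum>x\<le>k. w t x * f (Inr (Inl u)) t x)
        \<le> exp (- (4 * real T / real k)) * exp (2 * (3 * real T / (2 * real k)))"
      by (simp add: c_def)
    also have "\<dots> = exp (- (real T / real k))" by (simp flip: exp_add add: field_simps)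
    also have "\<dots> \<le> exp (- (3 * ln (real n)))" using Tk by simp
    finally show ?thesis by (simp add: ex)
  qed
  have pot3: "c (Inr (Inr ())) * (\<Prod>t<T. \<Sum>x\<le>k. w t x * f (Inr (Inr ())) t x) \<le> 1 / 3"
  proof -
    have "(\<Prod>t<T. \<Sum>x\<le>k. w t x * f (Inr (Inr ())) t x) = (\<Prod>t<T. 1 + (exp (-1) - 1) * W t)"
    proof (rule prod.cong[OF refl])
      fix t assume t: "t \<in> {..<T}"
      have "(\<Sum>x\<le>k. w t x * f (Inr (Inr ())) t x) = 1 + (exp (-1) - 1) * (\<Sum>x\<in>{..<k}. w t x)"
        unfolding f_def sum.case by (rule sum_weights_with_marked_choice[OF w_sum]) auto
      then show "(\<Sum>x\<le>k. w t x * f (Inr (Inr ())) t x) = 1 + (exp (-1) - 1) * W t" using W_eq by simp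
    qed
    also have "\<dots> \<le> exp ((exp (-1) - 1) * (\<Sum>t<T. W t))"
    proof (rule prod_le_exp_sum)
      fix t assume t: "t < T"
      have "(1 - exp (-1)) * W t \<le> 1 * 1" using W_bounds[OF t] by (intro mult_mono) auto
      then show "0 \<le> 1 + (exp (-1) - 1) * W t" by (simp add: algebra_simps)
    qed
    also have "(exp (-1) - 1) * (\<Sum>t<T. W t) \<le> - (1/2) * (\<Sum>t<T. W t)"
    proof (rule mult_right_mono)
      have "2 \<le> exp (1::real)" using exp_ge_add_one_self[of "1::real"] by simp
      then show "exp (-1) - 1 \<le> - (1/2 :: real)" by (simp add: exp_minus field_simps)
      show "0 \<le> (\<Sum>t<T. W t)" unfolding W_def using a_nonneg by (intro sum_nonneg) auto
    qed
    also have "\<dots> \<le> - (1/2) * (real T * (159 / 640))"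
    proof (rule mult_left_mono_neg)
      have "(\<Sum>t<T. 159 / 640) \<le> (\<Sum>t<T. W t)" using W_bounds by (intro sum_mono) auto
      then show "real T * (159 / 640) \<le> (\<Sum>t<T. W t)" by simp
    qed simp
    finally have "c (Inr (Inr ())) * (\<Prod>t<T. \<Sum>x\<le>k. w t x * f (Inr (Inr ())) t x)
        \<le> exp (real T / 10) * exp (- (1/2) * (real T * (159 / 640)))"
      by (simp add: c_def)
    also have "\<dots> = exp (real T / 10 - (1/2) * (real T * (159 / 640)))" by (simp flip: exp_add)
    \<comment> \<open>The exponent is \<open>- 31 / 1280 * T\<close>, and
      \<open>T \<ge> 100\<close>.\<close>
    also have "\<dots> \<le> exp (- 2)" using T_large by simp
    also have "\<dots> \<le> 1 / 3" using exp_ge_add_one_self[of "2::real"] by (simp add: exp_minus field_simps)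
    finally show ?thesis .
  qed
  have finI: "finite I" by (simp add: I_def)
  have "(\<Sum>i\<in>I. c i * (\<Prod>t<T. \<Sum>x\<le>k. w t x * f i t x))
    = (\<Sum>u<v. c (Inl u) * (\<Prod>t<T. \<Sum>x\<le>k. w t x * f (Inl u) t x)) +
      ((\<Sum>u<v. c (Inr (Inl u)) * (\<Prod>t<T. \<Sum>x\<le>k. w t x * f (Inr (Inl u)) t x)) +
       c (Inr (Inr ())) * (\<Prod>t<T. \<Sum>x\<le>k. w t x * f (Inr (Inr ())) t x))"
    unfolding I_def by (simp add: sum.Plus)
  also have "\<dots> \<le> (\<Sum>u<v. 1 / real n ^ 3) + ((\<Sum>u<v. 1 / real n ^ 3) + 1 / 3)"
    using pot1 pot2 pot3 by (intro add_mono sum_mono) auto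
  also have "\<dots> = 2 * (real v / real n ^ 3) + 1/3" by simp
  also have "\<dots> \<le> 2 * (real n / real n ^ 3) + 1/3"
    using v by (intro add_mono mult_left_mono divide_right_mono) auto
  also have "\<dots> = 2 / (real n * real n) + 1/3" using n_ge by (simp add: power3_eq_cube)
  also have "\<dots> \<le> 2 / (2 * 2) + 1/3"
    using n_ge by (intro add_mono divide_left_mono mult_mono) auto
  also have "\<dots> < 1" by simp
  finally have "(\<Sum>i\<in>I. c i * (\<Prod>t<T. \<Sum>x\<in>{..k}. w t x * f i t x)) < 1" .
  from exists_choice_product_potential[OF _ w_nonneg w_sum this]
  obtain \<phi> where \<phi>: "\<And>t. t < T \<Longrightarrow> \<phi> t \<le> k" "\<And>t. t < T \<Longrightarrow> 0 < w t (\<phi> t)"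
    and pot: "(\<Sum>i\<in>I. c i * (\<Prod>t<T. f i t (\<phi> t))) < 1" by auto
  have term_lt: "c i * (\<Prod>t<T. f i t (\<phi> t)) < 1" if "i \<in> I" for i
  proof -
    have "c i * (\<Prod>t<T. f i t (\<phi> t)) \<le> (\<Sum>i\<in>I. c i * (\<Prod>t<T. f i t (\<phi> t)))"
      using that finI
      by (intro member_le_sum mult_nonneg_nonneg prod_nonneg) (auto simp: c_def f_def split: sum.splits)
    then show ?thesis using pot by linarith
  qed
  define col' where "col' t x = (if x = v then \<phi> t else col t x)" for t x
  have shared_old: "shared col' u x = shared col u x" if "u < v" "x < v" for u x
    using that by (auto simp: shared_def col'_def)
  have shared_new: "shared col' u v = {t. t < T \<and> \<phi> t < k \<and> \<phi> t = col t u}" if "u < v" for u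
    using that by (auto simp: shared_def col'_def)
  \<comment> \<open>Positive weight forces the chosen class to have room and, through
    \<open>avoid_weight\<close>, to contain no neighbour of \<open>v\<close>; these two properties
    hold for every possible choice, whatever the potential.\<close>
  have open_phi: "\<phi> t \<in> open_classes col v t \<and> 0 < a t (\<phi> t)" if "t < T" "\<phi> t < k" for t
    using \<phi>(2)[OF that(1)] that by (auto simp: w_def split: if_splits)
  have "admissible (Suc v) X col'"
    unfolding admissible_def
  proof (intro conjI allI impI)
    fix x u assume xu: "x < Suc v" "u < x"
    show "X {u, x} \<longleftrightarrow> shared col' u x = {}"
    proof (cases "x = v")
      case False
      then show ?thesis using adm xu shared_old by (auto simp: admissible_def)
    next
      case True
      then have u: "u < v" using xu by simp
      have "shared col' u v = {}" if "Y u"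
      proof (rule ccontr)
        assume "shared col' u v \<noteq> {}"
        then obtain t where t: "t < T" "\<phi> t < k" "\<phi> t = col t u" using shared_new[OF u] by auto
        then have "u \<in> cls col v t (\<phi> t)" using u by (simp add: cls_def)
        then have "a t (\<phi> t) = 0" using avoid_weight_eq_0[of u _ Y] that by (simp add: a_def)
        then show False using open_phi[OF t(1,2)] by simp
      qed
      moreover have "Y u" if "shared col' u v = {}"
      proof (rule ccontr)
        assume "\<not> Y u"
        moreover have "(\<Prod>t<T. f (Inl u) t (\<phi> t)) = 1"
          using that shared_new[OF u] by (intro prod.neutral) (auto simp: f_def)
        moreover have "Inl u \<in> I" using u by (auto simp: I_def)
        ultimately show False using term_lt[of "Inl u"] by (simp add: c_def)
      qed
      ultimately show ?thesis using True by (auto simp: Y_def)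
    qed
    show "real (card (shared col' u x)) \<le> 4 * real T / real k"
    proof (cases "x = v")
      case False
      then show ?thesis using adm xu shared_old by (auto simp: admissible_def)
    next
      case True
      then have u: "u < v" using xu by simp
      have "(\<Prod>t<T. f (Inr (Inl u)) t (\<phi> t)) = exp 1 ^ card (shared col' u v)"
        unfolding f_def sum.case mem_Collect_eq shared_new[OF u] by (rule prod_marked_choices)
      also have "\<dots> = exp (real (card (shared col' u v)))" by (simp flip: exp_of_nat_mult)
      finally have "exp (real (card (shared col' u v)) - 4 * real T / real k) < 1"
        using term_lt[of "Inr (Inl u)"] u by (auto simp: c_def I_def simp flip: exp_add)
      then show ?thesis using True by simp
    qed
  next
    fix u assume u: "u < Suc v"
    show "real T / 10 \<le> real (card {t. t < T \<and> col' t u < k})"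
    proof (cases "u = v")
      case False
      then show ?thesis using adm u by (auto simp: admissible_def col'_def)
    next
      case True
      let ?R = "{t. t < T \<and> \<phi> t < k}"
      have "(\<Prod>t<T. f (Inr (Inr ())) t (\<phi> t)) = exp (-1) ^ card ?R"
        unfolding f_def sum.case lessThan_iff by (rule prod_marked_choices)
      also have "\<dots> = exp (- real (card ?R))" by (simp flip: exp_of_nat_mult)
      finally have "exp (real T / 10 - real (card ?R)) < 1"
        using term_lt[of "Inr (Inr ())"] by (auto simp: c_def I_def simp flip: exp_add)
      then show ?thesis using True by (simp add: col'_def)
    qed
  next
    fix t x assume tx: "t < T" "x < k"
    show "card (cls col' (Suc v) t x) \<le> s"
    proof (cases "x = \<phi> t")
      case True
      then have "cls col' (Suc v) t x = insert v (cls col v t x)"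
        by (auto simp: cls_def col'_def less_Suc_eq)
      moreover have "card (cls col v t x) < s"
        using open_phi[of t] tx True by (auto simp: open_classes_def)
      ultimately show ?thesis using card_insert_le_m1[of s "cls col v t x" v] by simp
    next
      case False
      then have "cls col' (Suc v) t x = cls col v t x"
        by (auto simp: cls_def col'_def less_Suc_eq)
      then show ?thesis using adm tx by (simp add: admissible_def)
    qed
  qed
  then show ?thesis by blast
qed

end

section \<open>The random graph\<close>

text \<open>The tuple of colours of a vertex is its image in the product, the \<open>i\<close>-th
  factor being large enough for all colours of \<open>col i\<close>. Injectivity is a separate
  premise because nonadjacent vertices could agree in every colour.\<close>

lemma pdim_le:
  fixes col :: "nat \<Rightarrow> 'a \<Rightarrow> nat"
  assumes fin: "finite (verts G)"
    and inj: "\<And>u v. u \<in> verts G \<Longrightarrow> v \<in> verts G \<Longrightarrow> \<forall>i<d. col i u = col i v \<Longrightarrow> u = v"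
    and adj: "\<And>u v. u \<in> verts G \<Longrightarrow> v \<in> verts G \<Longrightarrow>
      adj G u v \<longleftrightarrow> (\<forall>i<d. col i u \<noteq> col i v)"
  shows "pdim G \<le> d"
proof -
  let ?V = "verts G"
  define m where "m i = Suc (Max (insert 0 (col i ` ?V)))" for i
  define f where "f w = restrict (\<lambda>i. col i w) {..<d}" for w
  define P where "P = direct_product d (\<lambda>i. complete_graph (m i))"
  have col_lt: "col i w < m i" if "w \<in> ?V" for i w
    using that fin unfolding m_def by (intro le_imp_less_Suc Max_ge) auto
  have fP: "f w \<in> verts P" if "w \<in> ?V" for w
    using that col_lt by (auto simp: f_def P_def direct_product_def complete_graph_def)
  have "inj_on f ?V"
  proof (rule inj_onI)
    fix u v assume uv: "u \<in> ?V" "v \<in> ?V" "f u = f v"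
    have "col i u = col i v" if "i < d" for i
      using fun_cong[OF uv(3), of i] that by (simp add: f_def)
    then show "u = v" using inj uv by blast
  qed
  have adjP: "adj P (f u) (f v) \<longleftrightarrow> adj G u v" if uv: "u \<in> ?V" "v \<in> ?V" for u v
    using fP[OF uv(1)] fP[OF uv(2)] col_lt[OF uv(1)] col_lt[OF uv(2)] adj[OF uv]
    unfolding P_def adj_direct_product adj_complete_graph by (auto simp: f_def)
  define H where "H = \<lparr>verts = f ` ?V, edges = {e \<in> edges P. e \<subseteq> f ` ?V}\<rparr>"
  have "induced_subgraph H P"
    using fP by (auto simp: induced_subgraph_def H_def)
  moreover have "graph_iso G H"
    unfolding graph_iso_def
  proof (intro exI conjI ballI)
    show "bij_betw f (verts G) (verts H)"
      using \<open>inj_on f ?V\<close> by (simp add: bij_betw_def H_def)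
    show "adj G u v \<longleftrightarrow> adj H (f u) (f v)" if "u \<in> ?V" "v \<in> ?V" for u v
      using adjP[OF that] that by (simp add: adj_def H_def)
  qed
  ultimately have "\<exists>m. contains_induced (direct_product d (\<lambda>i. complete_graph (m i))) G"
    unfolding contains_induced_def P_def by blast
  then show ?thesis unfolding pdim_def by (rule Least_le)
qed

text \<open>Condition on the first component: on \<open>B\<close> the probability is bounded by 1,
  elsewhere by \<open>\<delta>\<close>. The first component will be the past edges, the second the
  edges to the next vertex.\<close>

lemma prob_pair_pmf_le:
  assumes "\<And>f. f \<notin> B \<Longrightarrow> measure_pmf.prob N {g. (f, g) \<in> S} \<le> \<delta>" "0 \<le> \<delta>"
  shows "measure_pmf.prob (pair_pmf M N) S \<le> measure_pmf.prob M B + \<delta>"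
proof -
  have "emeasure (pair_pmf M N) S = (\<integral>\<^sup>+x. indicator S x \<partial>pair_pmf M N)" by simp
  also have "\<dots> = (\<integral>\<^sup>+f. \<integral>\<^sup>+g. indicator S (f, g) \<partial>N \<partial>M)" by (rule nn_integral_pair_pmf')
  also have "\<dots> = (\<integral>\<^sup>+f. emeasure N {g. (f, g) \<in> S} \<partial>M)"
  proof (rule nn_integral_cong)
    fix f
    have "(\<integral>\<^sup>+g. indicator S (f, g) \<partial>N) = (\<integral>\<^sup>+g. indicator {g. (f, g) \<in> S} g \<partial>N)"
      by (intro nn_integral_cong) (auto simp: indicator_def)
    then show "(\<integral>\<^sup>+g. indicator S (f, g) \<partial>N) = emeasure N {g. (f, g) \<in> S}" by simp
  qed
  also have "\<dots> \<le> (\<integral>\<^sup>+f. indicator B f + ennreal \<delta> \<partial>M)"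
  proof (rule nn_integral_mono)
    fix f
    show "emeasure N {g. (f, g) \<in> S} \<le> indicator B f + ennreal \<delta>"
    proof (cases "f \<in> B")
      case True
      have "emeasure N {g. (f, g) \<in> S} \<le> 1" by (rule measure_pmf.emeasure_le_1)
      then show ?thesis using True by (simp add: add_increasing2)
    next
      case False
      then show ?thesis
        using assms(1)[OF False] by (simp add: measure_pmf.emeasure_eq_measure ennreal_leI)
    qed
  qed
  also have "\<dots> = emeasure M B + ennreal \<delta>"
    by (subst nn_integral_add) auto
  finally show ?thesis
    using assms(2) by (simp add: measure_pmf.emeasure_eq_measure flip: ennreal_plus)
qed

section \<open>Exposing the vertices one at a time\<close>

lemma all_pairs_lessThan_Suc:
  "all_pairs {..<Suc v} = all_pairs {..<v} \<union> (\<lambda>u. {u, v}) ` {..<v}"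
proof (intro equalityI subsetI)
  fix e assume "e \<in> all_pairs {..<Suc v}"
  then obtain x y where e: "e = {x, y}" "x \<noteq> y" "x < Suc v" "y < Suc v"
    by (auto simp: all_pairs_def card_2_iff)
  then consider "x < v" "y < v" | "x = v" "y < v" | "x < v" "y = v" by linarith
  then show "e \<in> all_pairs {..<v} \<union> (\<lambda>u. {u, v}) ` {..<v}"
    using e by cases (auto simp: all_pairs_def insert_commute)
qed (auto simp: all_pairs_def card_2_iff)

lemma new_pair_notin_all_pairs: "{u, v :: nat} \<notin> all_pairs {..<v}"
  by (auto simp: all_pairs_def)

lemma finite_all_pairs: "finite V \<Longrightarrow> finite (all_pairs V)"
  unfolding all_pairs_def by (rule finite_subset[of _ "Pow V"]) auto

lemma inj_on_pair: "inj_on (\<lambda>u. {u, v}) B"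
  by (auto simp: inj_on_def doubleton_eq_iff)

lemma avoid_weight_pair_image:
  "avoid_weight p B (\<lambda>u. g {u, v}) = avoid_weight p ((\<lambda>u. {u, v}) ` B) g"
  by (simp add: avoid_weight_def card_image[OF inj_on_pair])

context colouring_parameters
begin

lemma exp_6_ln: "exp (- (6 * ln (real n))) = 1 / real n ^ 6"
proof -
  have "exp (6 * ln (real n)) = real n ^ 6"
    using n_ge by (simp add: exp_of_nat_mult[of 6, simplified])
  then show ?thesis by (simp add: exp_minus field_simps)
qed

text \<open>Both families in \<open>typical\<close> satisfy one criterion: the number of terms
  divided by the multiplicity \<open>D\<close> is at least \<open>k / 80\<close>. The
  \<open>2560\<close> in \<open>spread\<close> is \<open>32 * 80\<close>, with \<open>32\<close>
  from \<open>avoid_weight_concentration\<close>.\<close>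

lemma atypical_family_prob:
  fixes v :: nat and B :: "'j \<Rightarrow> nat set"
  assumes J: "finite J" and D: "0 < D" and J_ge: "real k / 80 \<le> real (card J) / D"
    and B: "\<And>j. j \<in> J \<Longrightarrow> B j \<subseteq> {..<v}" "\<And>j. j \<in> J \<Longrightarrow> card (B j) \<le> s"
    and mult: "\<And>w. w < v \<Longrightarrow> real (card {j\<in>J. w \<in> B j}) \<le> D"
  shows "measure_pmf.prob (Pi_pmf ((\<lambda>u. {u, v}) ` {..<v}) False (\<lambda>_. bernoulli_pmf p))
      {g. \<not> \<bar>(\<Sum>j\<in>J. avoid_weight p (B j) (\<lambda>u. g {u, v})) - real (card J)\<bar> < real (card J) / 2}
    \<le> 2 / real n ^ 6"
proof -
  define M where "M = 1 / (1 - p) ^ s"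
  have "measure_pmf.prob (Pi_pmf ((\<lambda>u. {u, v}) ` {..<v}) False (\<lambda>_. bernoulli_pmf p))
      {g. \<bar>(\<Sum>j\<in>J. avoid_weight p ((\<lambda>u. {u, v}) ` B j) g) - real (card J)\<bar> \<ge> real (card J) / 2}
    \<le> 2 * exp (- (real (card J) / (32 * p * real s * D * M\<^sup>2)))"
  proof (rule avoid_weight_concentration[OF _ J p_pos p_le D ps_ge M_def])
    fix j assume j: "j \<in> J"
    show "(\<lambda>u. {u, v}) ` B j \<subseteq> (\<lambda>u. {u, v}) ` {..<v}" using B(1)[OF j] by blast
    show "card ((\<lambda>u. {u, v}) ` B j) \<le> s" using B(2)[OF j] by (simp add: card_image[OF inj_on_pair])
  next
    fix i assume "i \<in> (\<lambda>u. {u, v}) ` {..<v}"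
    then obtain w where w: "w < v" "i = {w, v}" by auto
    have "{j\<in>J. i \<in> (\<lambda>u. {u, v}) ` B j} = {j\<in>J. w \<in> B j}"
      unfolding w(2) by (auto simp: inj_on_image_mem_iff[OF inj_on_pair[of v UNIV]])
    then show "real (card {j\<in>J. i \<in> (\<lambda>u. {u, v}) ` B j}) \<le> D" using mult[OF w(1)] by simp
  qed simp
  also have "exp (- (real (card J) / (32 * p * real s * D * M\<^sup>2))) \<le> exp (- (6 * ln (real n)))"
  proof -
    have "6 * ln (real n) \<le> real k / (2560 * p * real s * M\<^sup>2)" using spread by (simp add: M_def)
    also have "\<dots> = (real k / 80) / (32 * p * real s * M\<^sup>2)" by simp
    also have "\<dots> \<le> (real (card J) / D) / (32 * p * real s * M\<^sup>2)"
      using J_ge p_pos by (intro divide_right_mono) auto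
    also have "\<dots> = real (card J) / (32 * p * real s * D * M\<^sup>2)" by (simp add: mult_ac)
    finally show ?thesis by simp
  qed
  finally show ?thesis
    by (simp add: exp_6_ln avoid_weight_pair_image not_less)
qed

lemma atypical_prob:
  assumes adm: "admissible v X col" and v: "v < n"
  shows "measure_pmf.prob (Pi_pmf ((\<lambda>u. {u, v}) ` {..<v}) False (\<lambda>_. bernoulli_pmf p))
      {g. \<not> typical v col (\<lambda>u. g {u, v})} \<le> 2 * (real n + real T) / real n ^ 6"
proof -
  let ?P = "Pi_pmf ((\<lambda>u. {u, v}) ` {..<v}) False (\<lambda>_. bernoulli_pmf p)"
  define E1 where "E1 u = {g. \<not> \<bar>(\<Sum>t\<in>open_times col v u. avoid_weight p (cls col v t (col t u) - {u}) (\<lambda>u. g {u, v}))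
              - real (card (open_times col v u))\<bar> < real (card (open_times col v u)) / 2}" for u
  define E2 where "E2 t = {g. \<not> \<bar>(\<Sum>c\<in>open_classes col v t. avoid_weight p (cls col v t c) (\<lambda>u. g {u, v}))
              - real (card (open_classes col v t))\<bar> < real (card (open_classes col v t)) / 2}" for t
  have T0: "0 < real T" using T_large by linarith
  have E1: "measure_pmf.prob ?P (E1 u) \<le> 2 / real n ^ 6" if u: "u < v" for u
    unfolding E1_def
  proof (rule atypical_family_prob)
    \<comment> \<open>By the invariant each \<open>w\<close> other than \<open>u\<close> lies in at
      most \<open>D = 4 * T / k\<close> of the classes, while there are at least
      \<open>T / 20\<close> of them: the quotient is at least \<open>k / 80\<close>.\<close>
    show "0 < 4 * real T / real k" using T0 k_pos by simp
    have "real k / 80 = (real T / 20) / (4 * real T / real k)" using T0 by simp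
    also have "\<dots> \<le> real (card (open_times col v u)) / (4 * real T / real k)"
      using card_open_times_ge[OF adm u] v by (intro divide_right_mono) auto
    finally show "real k / 80 \<le> real (card (open_times col v u)) / (4 * real T / real k)" .
  next
    fix t assume t: "t \<in> open_times col v u"
    show "cls col v t (col t u) - {u} \<subseteq> {..<v}" by (auto simp: cls_def)
    have "card (cls col v t (col t u) - {u}) \<le> card (cls col v t (col t u))"
      by (intro card_mono) auto
    then show "card (cls col v t (col t u) - {u}) \<le> s" using t by (simp add: open_times_def)
  next
    fix w assume w: "w < v"
    show "real (card {t \<in> open_times col v u. w \<in> cls col v t (col t u) - {u}}) \<le> 4 * real T / real k"
    proof (cases "w = u")
      case False
      have "card {t \<in> open_times col v u. w \<in> cls col v t (col t u) - {u}} \<le> card (shared col u w)"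
        by (intro card_mono) (auto simp: shared_def open_times_def cls_def)
      then show ?thesis using card_shared_le[OF adm u w] False by linarith
    qed simp
  qed simp
  have E2: "measure_pmf.prob ?P (E2 t) \<le> 2 / real n ^ 6" for t
    unfolding E2_def
  proof (rule atypical_family_prob)
    show "real k / 80 \<le> real (card (open_classes col v t)) / 1"
      using card_open_classes_ge[of v col t] v by simp
  next
    fix c assume "c \<in> open_classes col v t"
    then show "cls col v t c \<subseteq> {..<v}" "card (cls col v t c) \<le> s"
      by (auto simp: cls_def open_classes_def)
  next
    fix w
    \<comment> \<open>Classes of one colouring are disjoint, so \<open>D = 1\<close>.\<close>
    have "card {c \<in> open_classes col v t. w \<in> cls col v t c} \<le> card {col t w}"
      by (intro card_mono) (auto simp: cls_def)
    then show "real (card {c \<in> open_classes col v t. w \<in> cls col v t c}) \<le> 1" by simp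
  qed simp_all
  have "{g. \<not> typical v col (\<lambda>u. g {u, v})} = (\<Union>u<v. E1 u) \<union> (\<Union>t<T. E2 t)"
    unfolding typical_def E1_def E2_def by blast
  then have "measure_pmf.prob ?P {g. \<not> typical v col (\<lambda>u. g {u, v})}
      \<le> measure_pmf.prob ?P (\<Union>u<v. E1 u) + measure_pmf.prob ?P (\<Union>t<T. E2 t)"
    by (simp add: measure_Un_le)
  also have "\<dots> \<le> (\<Sum>u<v. measure_pmf.prob ?P (E1 u)) + (\<Sum>t<T. measure_pmf.prob ?P (E2 t))"
    by (intro add_mono measure_UNION_le) auto
  also have "\<dots> \<le> (\<Sum>u<v. 2 / real n ^ 6) + (\<Sum>t<T. 2 / real n ^ 6)"
    using E1 E2 by (intro add_mono sum_mono) auto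
  also have "\<dots> = (real v + real T) * (2 / real n ^ 6)" by (simp add: distrib_right add_divide_distrib)
  also have "\<dots> \<le> (real n + real T) * (2 / real n ^ 6)" using v by (intro mult_right_mono) auto
  finally show ?thesis by (simp add: mult_ac)
qed

text \<open>A family chosen for the predecessors of \<open>v\<close> is judged by the pairs below
  \<open>v\<close> alone; this leaves the edges from \<open>v\<close> independent of it.\<close>

lemma admissible_cong:
  assumes "\<And>u w. u < w \<Longrightarrow> w < v \<Longrightarrow> X {u, w} = X' {u, w}"
  shows "admissible v X col \<longleftrightarrow> admissible v X' col"
  using assms unfolding admissible_def by blast

text \<open>Union bound over the vertices: given an admissible family for the pairs below
  \<open>v\<close>, an extension can fail only if the independent edges from \<open>v\<close> to its
  predecessors are atypical.\<close>

lemma inadmissible_prob: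
  assumes "v \<le> n"
  shows "measure_pmf.prob (Pi_pmf (all_pairs {..<v}) False (\<lambda>_. bernoulli_pmf p))
      {X. \<nexists>col. admissible v X col} \<le> real v * (2 * (real n + real T) / real n ^ 6)"
  using assms
proof (induction v)
  case 0
  have "admissible 0 X col" for X col by (simp add: admissible_def cls_def)
  then show ?case by simp
next
  case (Suc v)
  define \<delta> where "\<delta> = 2 * (real n + real T) / real n ^ 6"
  let ?A = "all_pairs {..<v}" and ?E = "(\<lambda>u. {u, v}) ` {..<v}"
  let ?PA = "Pi_pmf ?A False (\<lambda>_. bernoulli_pmf p)" and ?PE = "Pi_pmf ?E False (\<lambda>_. bernoulli_pmf p)"
  define glue where "glue = (\<lambda>(f, g) x. if x \<in> ?A then f x else (g x :: bool))"
  define bad where "bad = {X. \<nexists>col. admissible v X col}"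
  have "Pi_pmf (all_pairs {..<Suc v}) False (\<lambda>_. bernoulli_pmf p) = map_pmf glue (pair_pmf ?PA ?PE)"
    unfolding all_pairs_lessThan_Suc glue_def
    using new_pair_notin_all_pairs by (intro Pi_pmf_union) (auto simp: finite_all_pairs)
  then have "measure_pmf.prob (Pi_pmf (all_pairs {..<Suc v}) False (\<lambda>_. bernoulli_pmf p))
      {X. \<nexists>col. admissible (Suc v) X col}
    = measure_pmf.prob (pair_pmf ?PA ?PE) (glue -` {X. \<nexists>col. admissible (Suc v) X col})"
    by simp
  also have "\<dots> \<le> measure_pmf.prob ?PA bad + \<delta>"
  proof (rule prob_pair_pmf_le)
    fix f assume "f \<notin> bad"
    then obtain col where col: "admissible v f col" by (auto simp: bad_def)
    have "{g. (f, g) \<in> glue -` {X. \<nexists>col. admissible (Suc v) X col}} \<subseteq> {g. \<not> typical v col (\<lambda>u. g {u, v})}"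
    proof (intro subsetI CollectI notI)
      fix g assume g: "g \<in> {g. (f, g) \<in> glue -` {X. \<nexists>col. admissible (Suc v) X col}}"
        and tp: "typical v col (\<lambda>u. g {u, v})"
      have "admissible v (glue (f, g)) col \<longleftrightarrow> admissible v f col"
        by (rule admissible_cong) (auto simp: glue_def all_pairs_def)
      moreover have "(\<lambda>u. glue (f, g) {u, v}) = (\<lambda>u. g {u, v})"
        using new_pair_notin_all_pairs by (auto simp: glue_def)
      ultimately have "\<exists>col'. admissible (Suc v) (glue (f, g)) col'"
        using admissible_extend[of v "glue (f, g)" col] col tp Suc.prems by simp
      then show False using g by auto
    qed
    then have "measure_pmf.prob ?PE {g. (f, g) \<in> glue -` {X. \<nexists>col. admissible (Suc v) X col}}
        \<le> measure_pmf.prob ?PE {g. \<not> typical v col (\<lambda>u. g {u, v})}"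
      by (intro measure_pmf.finite_measure_mono) auto
    also have "\<dots> \<le> \<delta>" unfolding \<delta>_def using atypical_prob[OF col] Suc.prems by simp
    finally show "measure_pmf.prob ?PE {g. (f, g) \<in> glue -` {X. \<nexists>col. admissible (Suc v) X col}} \<le> \<delta>" .
  qed (simp add: \<delta>_def)
  also have "\<dots> \<le> real v * \<delta> + \<delta>" using Suc unfolding bad_def \<delta>_def by simp
  finally show ?case by (simp add: \<delta>_def algebra_simps add_divide_distrib)
qed

lemma pdim_le_of_admissible:
  assumes adm: "admissible n X col"
  shows "pdim \<lparr>verts = {..<n}, edges = {e \<in> all_pairs {..<n}. X e}\<rparr> \<le> Suc T"
proof -
  let ?G = "\<lparr>verts = {..<n}, edges = {e \<in> all_pairs {..<n}. X e}\<rparr>"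
  \<comment> \<open>A vertex in no class of a colouring gets the private colour
    \<open>k + u\<close>. Colouring number \<open>T\<close> is injective; it makes the embedding
    injective and accounts for the \<open>Suc\<close>.\<close>
  define col' where "col' i u = (if i < T then if col i u < k then col i u else k + u else u)" for i u
  have less: "adj ?G u v \<longleftrightarrow> (\<forall>i<Suc T. col' i u \<noteq> col' i v)" if "u < v" "v < n" for u v
  proof -
    have "adj ?G u v \<longleftrightarrow> X {u, v}" using that by (auto simp: adj_def all_pairs_def)
    also have "\<dots> \<longleftrightarrow> shared col u v = {}" using adm that by (auto simp: admissible_def)
    also have "\<dots> \<longleftrightarrow> (\<forall>i<T. col' i u \<noteq> col' i v)"
      using that by (auto simp: shared_def col'_def)
    also have "\<dots> \<longleftrightarrow> (\<forall>i<Suc T. col' i u \<noteq> col' i v)"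
      using that by (auto simp: less_Suc_eq col'_def)
    finally show ?thesis .
  qed
  show ?thesis
  proof (rule pdim_le)
    show "finite (verts ?G)" by simp
    show "u = v" if "\<forall>i<Suc T. col' i u = col' i v" for u v
      using that by (auto simp: col'_def dest: spec[of _ T])
    show "adj ?G u v \<longleftrightarrow> (\<forall>i<Suc T. col' i u \<noteq> col' i v)" if "u \<in> verts ?G" "v \<in> verts ?G" for u v
    proof (cases u v rule: linorder_cases)
      case less
      then show ?thesis using \<open>\<And>u v. u < v \<Longrightarrow> v < n \<Longrightarrow> _\<close> that by simp
    next
      case equal
      then show ?thesis by (auto simp: adj_def all_pairs_def)
    next
      case greater
      then have "adj ?G v u \<longleftrightarrow> (\<forall>i<Suc T. col' i v \<noteq> col' i u)" using less that by simp
      then show ?thesis by (auto simp: adj_def insert_commute)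
    qed
  qed
qed

theorem pdim_Gnp_prob:
  "1 - 2 * (real n + real T) / real n ^ 5 \<le> measure_pmf.prob (Gnp n p) {G. pdim G \<le> Suc T}"
proof -
  let ?P = "Pi_pmf (all_pairs {..<n}) False (\<lambda>_. bernoulli_pmf p)"
  let ?S = "{X. \<exists>col. admissible n X col}"
  have "1 - 2 * (real n + real T) / real n ^ 5 = 1 - real n * (2 * (real n + real T) / real n ^ 6)"
    using n_ge by (simp add: field_simps eval_nat_numeral)
  also have "\<dots> \<le> 1 - measure_pmf.prob ?P {X. \<nexists>col. admissible n X col}"
    using inadmissible_prob[of n] by simp
  also have "\<dots> = measure_pmf.prob ?P ?S"
    using measure_pmf.prob_compl[of ?S ?P] by (simp add: Compl_eq_Diff_UNIV[symmetric] Collect_neg_eq[symmetric])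
  also have "\<dots> \<le> measure_pmf.prob ?P
      ((\<lambda>X. \<lparr>verts = {..<n}, edges = {e \<in> all_pairs {..<n}. X e}\<rparr>) -` {G. pdim G \<le> Suc T})"
    using pdim_le_of_admissible by (intro measure_pmf.finite_measure_mono) auto
  also have "\<dots> = measure_pmf.prob (Gnp n p) {G. pdim G \<le> Suc T}"
    by (simp add: Gnp_def)
  finally show ?thesis .
qed

end

section \<open>Choice of the parameters and the limit\<close>

lemma exp_ge_quadratic: "6 * y\<^sup>2 \<le> exp y" if "162 \<le> y" for y :: real
proof -
  have "y ^ 3 / 27 = (y / 3) ^ 3" by (simp add: power_divide)
  also have "\<dots> \<le> exp (y / 3) ^ 3"
  proof (rule power_mono)
    show "y / 3 \<le> exp (y / 3)" using exp_ge_add_one_self[of "y / 3"] by linarith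
  qed (use that in simp)
  also have "\<dots> = exp y" by (simp flip: exp_of_nat_mult)
  finally have "y ^ 3 / 27 \<le> exp y" .
  \<comment> \<open>The threshold is \<open>162 = 6 * 27\<close>: one factor of the cube absorbs
    both constants.\<close>
  moreover have "162 * y\<^sup>2 \<le> y * y\<^sup>2" using that by (intro mult_right_mono) auto
  ultimately show ?thesis by (simp add: power3_eq_cube power2_eq_square)
qed

lemma of_nat_ceiling_le: "real (nat \<lceil>x\<rceil>) \<le> x + 1" if "0 \<le> x" for x :: real
  using that by linarith

lemma inverse_power_one_minus_le:
  fixes p :: real
  assumes "0 \<le> p" "p \<le> 1/2"
  shows "1 / (1 - p) ^ s \<le> exp (2 * p * real s)"
proof -
  have "2 * p\<^sup>2 \<le> p" using assms mult_left_mono[of "2 * p" 1 p] by (simp add: power2_eq_square)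
  then have "- (2 * p) \<le> ln (1 - p)" using ln_one_minus_pos_lower_bound[OF assms] by linarith
  then have "exp (- (2 * p)) \<le> 1 - p" using assms by (simp add: ln_ge_iff)
  then have "exp (- (2 * p)) ^ s \<le> (1 - p) ^ s" by (intro power_mono) auto
  moreover have "exp (- (2 * p)) ^ s = exp (- (2 * p * real s))"
    by (simp flip: exp_of_nat_mult add: mult_ac)
  ultimately have "1 / (1 - p) ^ s \<le> 1 / exp (- (2 * p * real s))"
    using assms by (intro divide_left_mono) auto
  then show ?thesis by (simp add: exp_minus field_simps)
qed

lemma pdim_Gnp_sparse_prob:
  fixes n :: nat and p :: real
  assumes p: "0 < p" "p \<le> 1/2" and N: "1 \<le> ln (real n)" "(ln (real n))\<^sup>2 \<le> p * real n"
    and L: "648 \<le> ln (p * real n)"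
  shows "1 - 2 * (1 + 1229042) / real n \<le> measure_pmf.prob (Gnp n p)
    {G. real (pdim G) \<le> 1229042 * (p * real n * ln (real n) / ln (p * real n))}"
proof -
  define x L N where "x = p * real n" and "L = ln x" and "N = ln (real n)"
  \<comment> \<open>With this \<open>s\<close> the factor \<open>1 / (1 - p) ^ s\<close> is at most
    \<open>exp (L / 8)\<close>, a small power of \<open>x\<close>. Rounding costs at most a factor
    2, since \<open>L / (16 * p) \<ge> 2\<close>.\<close>
  define s where "s = nat \<lfloor>L / (16 * p)\<rfloor>"
  define k where "k = nat \<lceil>160 * real n / real s\<rceil>"
  define T where "T = nat \<lceil>240 * real k * N\<rceil>"
  have n: "n \<ge> 2"
  proof (rule ccontr)
    assume "\<not> n \<ge> 2"
    then have "n = 0 \<or> n = 1" by auto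
    then show False using N by auto
  qed
  have x: "x > 0" using p n by (simp add: x_def)
  have L648: "648 \<le> L" using L by (simp add: L_def x_def)
  have N1: "1 \<le> N" using N by (simp add: N_def)
  have expL: "exp L = x" using x by (simp add: L_def)
  have Lx: "L \<le> x" using exp_ge_add_one_self[of L] expL by linarith
  have s0: "2 \<le> L / (16 * p)"
    using p L648 by (simp add: pos_le_divide_eq)
  have s_le: "real s \<le> L / (16 * p)" using s0 unfolding s_def by linarith
  have s_gt: "L / (16 * p) - 1 < real s" using s0 unfolding s_def by linarith
  have s_ge: "L / (32 * p) \<le> real s" using s_gt s0 by simp
  have s2: "2 \<le> s" using s0 unfolding s_def by linarith
  have k_ge: "160 * real n / real s \<le> real k" unfolding k_def by linarith
  have k_le: "real k \<le> 160 * real n / real s + 1"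
    using of_nat_ceiling_le[of "160 * real n / real s"] unfolding k_def by simp
  have "160 * real n / real s \<le> 160 * real n / (L / (32 * p))"
    using s_ge s2 p L648 by (intro divide_left_mono mult_pos_pos) auto
  also have "\<dots> = 5120 * (x / L)" by (simp add: x_def)
  \<comment> \<open>The \<open>1\<close> from rounding \<open>k\<close> is at most
    \<open>x / L\<close>, so \<open>5120 = 160 * 32\<close> becomes \<open>5121\<close>.\<close>
  finally have k_le': "real k \<le> 5121 * (x / L)"
    using k_le Lx L648 pos_le_divide_eq[of L 1 x] by linarith
  have T_ge: "240 * real k * N \<le> real T" unfolding T_def by linarith
  have "real T \<le> 240 * real k * N + 1" 
    using of_nat_ceiling_le[of "240 * real k * N"] N1 unfolding T_def by simp
  also have "240 * real k * N \<le> 240 * (5121 * (x / L)) * N"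
    using k_le' N1 by (intro mult_right_mono mult_left_mono) auto
  finally have T_le: "real T \<le> 1229040 * (x * N / L) + 1" by simp
  have xNL: "1 \<le> x * N / L"
  proof -
    have "L * 1 \<le> x * N" using Lx N1 x by (intro mult_mono) auto
    then show ?thesis using L648 by simp
  qed
  \<comment> \<open>Here \<open>1229040 = 240 * 5121\<close>; the rounding of \<open>T\<close> and
    the injective colouring each add 1, which is at most \<open>Q\<close>.\<close>
  have "real (Suc T) \<le> 1229042 * Q" if "real T \<le> 1229040 * Q + 1" "1 \<le> Q" for Q
    using that by simp
  from this[OF T_le xNL] have T_le': "real (Suc T) \<le> 1229042 * (x * N / L)" .
  have psL: "L / 32 \<le> p * real s" using s_ge p by (simp add: field_simps)
  have psL': "p * real s \<le> L / 16" using s_le p by (simp add: field_simps)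
  interpret colouring_parameters n k s T p
  proof
    show "160 * real n \<le> real k * real s" using k_ge s2 by (simp add: pos_divide_le_eq)
    show "240 * real k * ln (real n) \<le> real T" using T_ge by (simp add: N_def)
    show "1 \<le> 8 * p * real s" using psL L648 by simp
    define M where "M = 1 / (1 - p) ^ s"
    have "M \<le> exp (2 * p * real s)" unfolding M_def using p by (intro inverse_power_one_minus_le) auto
    also have "\<dots> \<le> exp (L / 8)" using psL' by simp
    finally have "M\<^sup>2 \<le> (exp (L / 8))\<^sup>2" using p by (intro power_mono) (auto simp: M_def)
    then have M: "M\<^sup>2 \<le> exp (L / 4)" by (simp flip: exp_double)
    have M0: "0 < M\<^sup>2" using p by (simp add: M_def)
    have "N \<le> exp (L / 2)"
    proof (rule power2_le_imp_le)
      have "(exp (L / 2))\<^sup>2 = x" using expL by (simp flip: exp_double)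
      then show "N\<^sup>2 \<le> (exp (L / 2))\<^sup>2" using N(2) by (simp add: N_def x_def)
    qed simp
    \<comment> \<open>Up to constants the bound is
      \<open>exp (L / 2) * L\<^sup>2 * exp (L / 4) / p\<close>, where the first factor comes from
      \<open>N\<^sup>2 \<le> x\<close> and the last exponential from \<open>M\<close>. Since
      \<open>exp L / p = n\<close>, another \<open>exp (L / 4)\<close> is available to absorb
      \<open>L\<^sup>2\<close>; this needs \<open>L / 4 \<ge> 162\<close>, hence the
      \<open>648\<close>.\<close>
    then have "6 * N * (2560 * (p * real s) * real s * M\<^sup>2) \<le>
        6 * exp (L / 2) * (2560 * (L / 16) * (L / (16 * p)) * exp (L / 4))"
      using N1 p psL' s_le M M0 L648 by (intro mult_mono) auto
    also have "\<dots> = (60 * L\<^sup>2 * exp (L / 2) * exp (L / 4)) / p"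
      using p by (simp add: power2_eq_square)
    also have "\<dots> \<le> (160 * exp (L / 4) * exp (L / 2) * exp (L / 4)) / p"
    proof -
      have "6 * (L / 4)\<^sup>2 \<le> exp (L / 4)" using L648 by (intro exp_ge_quadratic) simp
      then have "60 * L\<^sup>2 \<le> 160 * exp (L / 4)" by (simp add: power_divide)
      then show ?thesis using p by (intro divide_right_mono mult_right_mono) auto
    qed
    also have "160 * exp (L / 4) * exp (L / 2) * exp (L / 4) = 160 * exp L"
      by (simp flip: exp_add add: mult.assoc)
    also have "160 * exp L / p = 160 * real n" using p by (simp add: expL x_def)
    also have "\<dots> \<le> real k * real s" using k_ge s2 by (simp add: pos_divide_le_eq)
    finally have "(6 * N * (2560 * p * real s * M\<^sup>2)) * real s \<le> real k * real s"
      by (simp add: mult_ac)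
    then have "6 * N * (2560 * p * real s * M\<^sup>2) \<le> real k"
      by (rule mult_right_le_imp_le) (use s2 in simp)
    moreover have "0 < 2560 * p * real s * M\<^sup>2" using p s2 M0 by simp
    ultimately have "6 * N \<le> real k / (2560 * p * real s * M\<^sup>2)" by (simp only: pos_le_divide_eq)
    then show "6 * ln (real n) \<le> real k / (2560 * p * real s * (1 / (1 - p) ^ s)\<^sup>2)"
      by (simp only: N_def M_def)
  qed (use p n s2 in auto)
  have "real T \<le> 1229042 * (x * N / L)" by (rule order_trans[OF _ T_le']) simp
  \<comment> \<open>A crude polynomial bound on \<open>T\<close> is enough to make the failure
    probability tend to 0.\<close>
  also have "x * N / L \<le> real n * real n"
  proof -
    have "x \<le> real n" using p by (simp add: x_def mult_left_le_one_le)
    moreover have "N \<le> real n" using ln_le_minus_one[of "real n"] n unfolding N_def by simp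
    moreover have "x * N / L \<le> x * N / 1" using x N1 L648 by (intro divide_left_mono) auto
    ultimately show ?thesis using mult_mono[of x "real n" N "real n"] x N1 by simp
  qed
  finally have "real T \<le> 1229042 * (real n)\<^sup>2" by (simp add: power2_eq_square)
  moreover have "real n \<le> (real n)\<^sup>2" using n by (simp add: power2_eq_square)
  ultimately have "real n + real T \<le> (1 + 1229042) * (real n)\<^sup>2"
    unfolding distrib_right mult_1 by (intro add_mono)
  then have "2 * (real n + real T) / real n ^ 5 \<le> 2 * ((1 + 1229042) * (real n)\<^sup>2) / real n ^ 5"
    by (intro divide_right_mono mult_left_mono) auto
  also have "\<dots> = 2 * (1 + 1229042) / real n ^ 3"
    using n by (simp add: eval_nat_numeral)
  also have "\<dots> \<le> 2 * (1 + 1229042) / real n"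
    using n by (intro divide_left_mono self_le_power) auto
  finally have "1 - 2 * (1 + 1229042) / real n \<le> 1 - 2 * (real n + real T) / real n ^ 5" by simp
  also have "\<dots> \<le> measure_pmf.prob (Gnp n p) {G. pdim G \<le> Suc T}" by (rule pdim_Gnp_prob)
  also have "\<dots> \<le> measure_pmf.prob (Gnp n p) {G. real (pdim G) \<le> 1229042 * (x * N / L)}"
  proof (rule measure_pmf.finite_measure_mono)
    show "{G. pdim G \<le> Suc T} \<subseteq> {G. real (pdim G) \<le> 1229042 * (x * N / L)}"
      using T_le' by (auto intro: order_trans[rotated])
  qed simp
  finally show ?thesis by (simp add: x_def N_def L_def)
qed

theorem theorem1p1:
  fixes \<epsilon> :: real
  assumes "0 < \<epsilon>" and "\<epsilon> < 1"
  shows "\<exists>C>0. \<forall>p :: nat \<Rightarrow> real.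
    (\<forall>\<^sub>F n in sequentially.
        ln (real n) powr (2 + \<epsilon>) / real n \<le> p n \<and> p n < real n powr (- \<epsilon>)) \<longrightarrow>
    (\<lambda>n. measure_pmf.prob (Gnp n (p n))
           {G. real (pdim G) \<le> C * (p n * real n * ln (real n) / ln (p n * real n))})
      \<longlonglongrightarrow> 1"
proof (intro exI conjI allI impI)
  show "(0::real) < 1229042" by simp
  fix p :: "nat \<Rightarrow> real"
  assume p: "\<forall>\<^sub>F n in sequentially.
    ln (real n) powr (2 + \<epsilon>) / real n \<le> p n \<and> p n < real n powr (- \<epsilon>)"
  let ?P = "\<lambda>n. measure_pmf.prob (Gnp n (p n))
    {G. real (pdim G) \<le> 1229042 * (p n * real n * ln (real n) / ln (p n * real n))}"
  have ln_top: "filterlim (\<lambda>n. ln (real n)) at_top sequentially"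
    by (rule filterlim_compose[OF ln_at_top filterlim_real_sequentially])
  \<comment> \<open>Squaring gives \<open>exp 648 \<le> (ln n)\<^sup>2 \<le> p * n\<close>, so
    \<open>ln (p * n)\<close> reaches the size required by
    \<open>pdim_Gnp_sparse_prob\<close>.\<close>
  then have ev1: "\<forall>\<^sub>F n in sequentially. exp 324 \<le> ln (real n)"
    by (simp add: filterlim_at_top)
  have "(\<lambda>n. real n powr (- \<epsilon>)) \<longlonglongrightarrow> 0"
    using assms by (intro tendsto_neg_powr filterlim_real_sequentially) auto
  \<comment> \<open>With the upper bound on \<open>p\<close>, this gives
    \<open>p n \<le> 1/2\<close> eventually.\<close>
  then have ev2: "\<forall>\<^sub>F n in sequentially. real n powr (- \<epsilon>) < 1/2"
    by (rule order_tendstoD) simp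
  have lower: "\<forall>\<^sub>F n in sequentially. 1 - 2 * (1 + 1229042) / real n \<le> ?P n"
    using p ev1 ev2 eventually_gt_at_top[of 0]
  proof eventually_elim
    case (elim n)
    let ?N = "ln (real n)"
    have e1: "1 \<le> exp (324::real)" by simp
    then have N1: "1 \<le> ?N" using elim(2) by linarith
    have "?N\<^sup>2 = ?N powr 2" using N1 by simp
    also have "\<dots> \<le> ?N powr (2 + \<epsilon>)" using N1 assms by (intro powr_mono) auto
    also have "\<dots> \<le> p n * real n" using elim(1,4) by (simp add: pos_divide_le_eq)
    finally have Np: "?N\<^sup>2 \<le> p n * real n" .
    have "exp 648 = (exp (324::real))\<^sup>2" by (simp flip: exp_double)
    also have "\<dots> \<le> ?N\<^sup>2" using elim(2) by (intro power_mono) auto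
    finally have x: "exp 648 \<le> p n * real n" using Np by linarith
    then have x0: "0 < p n * real n" by (meson exp_gt_zero order_less_le_trans)
    then have "648 \<le> ln (p n * real n)" using x by (simp add: ln_ge_iff)
    moreover have "0 < p n" using x0 elim(4) by (simp add: zero_less_mult_iff)
    ultimately show ?case using N1 Np elim(1,3) by (intro pdim_Gnp_sparse_prob) auto
  qed
  show "?P \<longlonglongrightarrow> 1"
  proof (rule tendsto_sandwich[OF lower])
    show "\<forall>\<^sub>F n in sequentially. ?P n \<le> 1" by simp
    have "(\<lambda>n. 1 - 2 * (1 + 1229042) / real n) \<longlonglongrightarrow> 1 - 0"
      by (intro tendsto_diff tendsto_const lim_const_over_n)
    then show "(\<lambda>n. 1 - 2 * (1 + 1229042) / real n) \<longlonglongrightarrow> 1" by simp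
  qed simp
qed

end
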